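(* Let $p\ge 1$, $\alpha>0$, $r>0$, and let $\mu$ be a positive Borel measure on $\mathbb{C}^n$. Then $\mu$ is a vanishing $p$-Carleson measure if and only if $\mu(B(z,r))\to 0$ as $z\to\infty$.
   Context: $dA$ is Lebesgue measure on $\mathbb{C}^n$ and $B(z,r)$ is the Euclidean ball of center $z$ and radius $r$. A function $f:\mathbb{C}^n\to\mathbb{C}$ is pluriharmonic if $\partial^2 f/\partial z_j\partial\bar z_k=0$ for all $j,k\in\{1,\dots,n\}$. $L^p_\alpha$ is the space of Lebesgue measurable functions $f$ on $\mathbb{C}^n$ with $\|f\|_{p,\alpha}^p=\frac{p^n}{(2\pi\alpha)^n}\int_{\mathbb{C}^n}|f(z)e^{-|z|^2/(2\alpha)}|^p\,dA(z)<\infty$, and $\mathcal{PH}^p_\alpha(\mathbb{C}^n)$ is the subspace of all pluriharmonic functions belonging to $L^p_\alpha$. A positive Borel measure $\mu$ on $\mathbb{C}^n$ is a vanishing $p$-Carleson measure if $\lim_{m\to\infty}\int_{\mathbb{C}^n}|f_m(z)e^{-|z|^2/(2\alpha)}|^p\,d\mu(z)=0$ for every sequence $(f_m)$ that is bounded in $\mathcal{PH}^p_\alpha(\mathbb{C}^n)$ and converges to $0$ uniformly on compact subsets of $\mathbb{C}^n$.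
   Formalization: The positive Borel measure μ is additionally assumed finite on compact sets; without this the claim fails, e.g. for an infinite point mass at 0, where μ(B(z,r)) → 0 but the integrals of the constants 1/(m+1) are infinite. *)

theory Defs
  imports "HOL-Analysis.Analysis"
begin

definition dir_deriv :: "complex ^ 'n \<Rightarrow> (complex ^ 'n \<Rightarrow> complex) \<Rightarrow> complex ^ 'n \<Rightarrow> complex" where
  "dir_deriv v f z = frechet_derivative f (at z) v"

text \<open>Class \<open>C\<^sup>2\<close> in the real sense. The library derivative is a total function, so differentiability
  has to be required before its values mean anything.\<close>

definition twice_cont_differentiable :: "(complex ^ 'n \<Rightarrow> complex) \<Rightarrow> bool" where
  "twice_cont_differentiable f \<longleftrightarrow>
     (\<forall>z. f differentiable (at z)) \<and>
     (\<forall>v z. dir_deriv v f differentiable (at z)) \<and>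
     (\<forall>v w. continuous_on UNIV (dir_deriv w (dir_deriv v f)))"

text \<open>Wirtinger derivatives: with \<open>z\<^sub>j = x\<^sub>j + \<i> y\<^sub>j\<close>, the real partial derivatives with respect to
  \<open>x\<^sub>j\<close> and \<open>y\<^sub>j\<close> are those in the directions \<open>axis j 1\<close> and \<open>axis j \<i>\<close>.\<close>

definition wirtinger :: "'n \<Rightarrow> (complex ^ 'n \<Rightarrow> complex) \<Rightarrow> complex ^ 'n \<Rightarrow> complex" where
  "wirtinger j f z = (dir_deriv (axis j 1) f z - \<i> * dir_deriv (axis j \<i>) f z) / 2"

definition wirtinger_bar :: "'n \<Rightarrow> (complex ^ 'n \<Rightarrow> complex) \<Rightarrow> complex ^ 'n \<Rightarrow> complex" where
  "wirtinger_bar j f z = (dir_deriv (axis j 1) f z + \<i> * dir_deriv (axis j \<i>) f z) / 2"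

definition pluriharmonic :: "(complex ^ 'n \<Rightarrow> complex) \<Rightarrow> bool" where
  "pluriharmonic f \<longleftrightarrow>
     twice_cont_differentiable f \<and> (\<forall>j k z. wirtinger j (wirtinger_bar k f) z = 0)"

definition weighted_power :: "real \<Rightarrow> real \<Rightarrow> (complex ^ 'n \<Rightarrow> complex) \<Rightarrow> complex ^ 'n \<Rightarrow> real" where
  "weighted_power p \<alpha> f z = cmod (f z * of_real (exp (- (norm z)\<^sup>2 / (2 * \<alpha>)))) powr p"

text \<open>The \<open>p\<close>-th power of the norm, as an extended nonnegative real.\<close>

definition Lp_norm_power :: "real \<Rightarrow> real \<Rightarrow> (complex ^ 'n \<Rightarrow> complex) \<Rightarrow> ennreal" where
  "Lp_norm_power p \<alpha> f =
     ennreal (p ^ CARD('n) / (2 * pi * \<alpha>) ^ CARD('n)) *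
     (\<integral>\<^sup>+ z. ennreal (weighted_power p \<alpha> f z) \<partial>lebesgue)"

definition Lp_space :: "real \<Rightarrow> real \<Rightarrow> (complex ^ 'n \<Rightarrow> complex) set" where
  "Lp_space p \<alpha> = {f. f \<in> borel_measurable lebesgue \<and> Lp_norm_power p \<alpha> f < \<infinity>}"

text \<open>Only meaningful on \<^const>\<open>Lp_space\<close>, since \<^const>\<open>enn2real\<close> sends \<open>\<infinity>\<close> to \<open>0\<close>.\<close>

definition Lp_norm :: "real \<Rightarrow> real \<Rightarrow> (complex ^ 'n \<Rightarrow> complex) \<Rightarrow> real" where
  "Lp_norm p \<alpha> f = enn2real (Lp_norm_power p \<alpha> f) powr (1 / p)"

definition PH_space :: "real \<Rightarrow> real \<Rightarrow> (complex ^ 'n \<Rightarrow> complex) set" where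
  "PH_space p \<alpha> = {f \<in> Lp_space p \<alpha>. pluriharmonic f}"

definition vanishing_Carleson :: "real \<Rightarrow> real \<Rightarrow> (complex ^ 'n) measure \<Rightarrow> bool" where
  "vanishing_Carleson p \<alpha> \<mu> \<longleftrightarrow>
     (\<forall>f :: nat \<Rightarrow> complex ^ 'n \<Rightarrow> complex.
        (\<forall>m. f m \<in> PH_space p \<alpha>) \<and>
        (\<exists>C. \<forall>m. Lp_norm p \<alpha> (f m) \<le> C) \<and>
        (\<forall>K. compact K \<longrightarrow> uniform_limit K f (\<lambda>_. 0) sequentially) \<longrightarrow>
        (\<lambda>m. \<integral>\<^sup>+ z. ennreal (weighted_power p \<alpha> (f m) z) \<partial>\<mu>) \<longlonglongrightarrow> 0)"

text \<open>As is usual on \<open>\<complex>\<^sup>n\<close>, Borel measures are finite on compact sets. Without this the equivalence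
  fails: an infinite point mass at \<open>0\<close> gives \<open>\<mu>(B(z,r)) = 0\<close> for large \<open>z\<close>, while the integrals of
  the constant functions \<open>1/(m+1)\<close> are all infinite.\<close>

definition borel_measure_on_Cn :: "(complex ^ 'n) measure \<Rightarrow> bool" where
  "borel_measure_on_Cn \<mu> \<longleftrightarrow>
     sets \<mu> = sets borel \<and> (\<forall>K. compact K \<longrightarrow> emeasure \<mu> K < \<infinity>)"

end

theory Submission
  imports Defs "HOL-Complex_Analysis.Complex_Analysis" "HOL-Probability.Distributions"
    "HOL-Real_Asymp.Real_Asymp"
begin

text \<open>
  For the forward direction, test with \<open>f\<^sub>a(w) = exp (\<langle>w, a\<rangle> / \<alpha> - \<bar>a\<bar>\<^sup>2 / (2\<alpha>))\<close>: the weighted modulus is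
  \<open>exp (- \<bar>w - a\<bar>\<^sup>2 / (2\<alpha>))\<close>, so the norms do not depend on \<open>a\<close> and the integral against \<open>\<mu>\<close> controls
  \<open>\<mu>(B(a,r))\<close>.

  For the converse, the point is a local estimate
  \<open>F(z)\<^sup>p \<le> C \<integral>\<^bsub>B(z,\<rho>)\<^esub> F\<^sup>p dA\<close> with \<open>F(z) = \<bar>f(z)\<bar> exp (- \<bar>z\<bar>\<^sup>2 / (2\<alpha>))\<close> and \<open>C\<close> independent of \<open>z\<close>. The weight
  factors over the coordinates, so it suffices to treat one complex variable and iterate. There
  \<open>u = g + cnj h\<close> with \<open>g\<close>, \<open>h\<close> entire, and the claim is \<open>\<bar>u(0)\<bar> \<le> C \<integral>\<^bsub>D\<^esub> \<bar>u(w) exp (- a w)\<bar> dA\<close> uniformly in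
  \<open>a\<close>. Since \<open>u exp (- a w)\<close> is not harmonic, one estimates \<open>g'\<close> and \<open>h'\<close> instead, to which the
  holomorphic factor can be attached, and integrates them along a segment on which the resulting bound
  decays exponentially. Given the local estimate, Tonelli's theorem bounds the integral of \<open>F\<^sup>p\<close> against \<open>\<mu>\<close>
  by the integral of \<open>F(w)\<^sup>p \<mu>(B(w,\<rho>))\<close>, which is split at a large radius.
\<close>

section \<open>Lebesgue measure on the complex plane\<close>

lemma measurable_Complex_pair [measurable]:
  "(\<lambda>x. Complex (fst x) (snd x)) \<in> borel_measurable (lborel \<Otimes>\<^sub>M lborel)"
proof -
  have "(\<lambda>x :: real \<times> real. Complex (fst x) (snd x)) \<in> borel_measurable borel"
    unfolding Complex_eq by (intro borel_measurable_continuous_onI continuous_intros)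
  then show ?thesis
    by (simp add: lborel_prod)
qed

text \<open>Both measures give each box the product of its side lengths, and this determines
  Lebesgue measure. It opens integrals over the plane to Tonelli's theorem in the real and imaginary
  parts.\<close>

lemma lborel_complex_eq: "(lborel :: complex measure) = distr (lborel \<Otimes>\<^sub>M lborel) borel (\<lambda>(x, y). Complex x y)"
proof (rule lborel_eqI)
  fix l u :: complex
  assume lu: "\<And>b. b \<in> Basis \<Longrightarrow> l \<bullet> b \<le> u \<bullet> b"
  have le: "Re l \<le> Re u" "Im l \<le> Im u"
    using lu[of 1] lu[of \<i>] by (auto simp: Basis_complex_def inner_complex_def)
  have m: "(\<lambda>(x, y). Complex x y) \<in> borel_measurable (lborel \<Otimes>\<^sub>M lborel)"
    using measurable_Complex_pair by (simp add: split_beta')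
  have "(\<lambda>(x, y). Complex x y) -` box l u \<inter> space (lborel \<Otimes>\<^sub>M lborel)
      = {Re l<..<Re u} \<times> {Im l<..<Im u}"
    by (auto simp: in_box_complex_iff space_pair_measure)
  then have "emeasure (distr (lborel \<Otimes>\<^sub>M lborel) borel (\<lambda>(x, y). Complex x y)) (box l u)
      = emeasure (lborel \<Otimes>\<^sub>M lborel) ({Re l<..<Re u} \<times> {Im l<..<Im u})"
    by (subst emeasure_distr[OF m]) auto
  also have "\<dots> = ennreal (Re u - Re l) * ennreal (Im u - Im l)"
    using le by (subst lborel.emeasure_pair_measure_Times) auto
  also have "\<dots> = ennreal (\<Prod>b\<in>Basis. (u - l) \<bullet> b)"
    using le by (simp add: Basis_complex_def inner_complex_def ennreal_mult)
  finally show "emeasure (distr (lborel \<Otimes>\<^sub>M lborel) borel (\<lambda>(x, y). Complex x y)) (box l u)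
      = ennreal (\<Prod>b\<in>Basis. (u - l) \<bullet> b)" .
qed simp

lemma nn_integral_complex_iterated:
  fixes f :: "complex \<Rightarrow> ennreal"
  assumes [measurable]: "f \<in> borel_measurable borel"
  shows "(\<integral>\<^sup>+w. f w \<partial>lborel) = (\<integral>\<^sup>+y. \<integral>\<^sup>+x. f (Complex x y) \<partial>lborel \<partial>lborel)" (is ?A)
    and "(\<integral>\<^sup>+w. f w \<partial>lborel) = (\<integral>\<^sup>+x. \<integral>\<^sup>+y. f (Complex x y) \<partial>lborel \<partial>lborel)" (is ?B)
proof -
  have *: "(\<integral>\<^sup>+w. f w \<partial>lborel) = (\<integral>\<^sup>+z. f (Complex (fst z) (snd z)) \<partial>(lborel \<Otimes>\<^sub>M lborel))"
    by (subst lborel_complex_eq, subst nn_integral_distr) (auto simp: split_beta')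
  show ?B
    unfolding * by (subst lborel.nn_integral_fst[symmetric]) auto
  show ?A
    unfolding * by (subst lborel_pair.nn_integral_snd[symmetric]) auto
qed

lemma nn_integral_translate:
  fixes f :: "'a::euclidean_space \<Rightarrow> ennreal"
  assumes [measurable]: "f \<in> borel_measurable borel"
  shows "(\<integral>\<^sup>+x. f (a + x) \<partial>lborel) = (\<integral>\<^sup>+x. f x \<partial>lborel)"
  by (subst (2) lborel_distr_plus[of a, symmetric], subst nn_integral_distr) auto

text \<open>On each horizontal line the shear is a translation, so the inner integral over the real
  part is unchanged.\<close>

lemma nn_integral_shear_Re:
  fixes f :: "complex \<Rightarrow> ennreal"
  assumes [measurable]: "f \<in> borel_measurable borel"
  shows "(\<integral>\<^sup>+w. f (w + of_real (t * Im w)) \<partial>lborel) = (\<integral>\<^sup>+w. f w \<partial>lborel)"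
proof -
  have "(\<integral>\<^sup>+w. f (w + of_real (t * Im w)) \<partial>lborel)
      = (\<integral>\<^sup>+y. \<integral>\<^sup>+x. f (Complex (t * y + x) y) \<partial>lborel \<partial>lborel)"
    by (subst nn_integral_complex_iterated(1)) (auto simp: complex_eq_iff intro!: nn_integral_cong arg_cong[of _ _ f])
  also have "\<dots> = (\<integral>\<^sup>+y. \<integral>\<^sup>+x. f (Complex x y) \<partial>lborel \<partial>lborel)"
  proof (rule nn_integral_cong)
    fix y :: real
    have [measurable]: "(\<lambda>x. Complex x y) \<in> borel_measurable borel"
      by (simp add: Complex_eq)
    show "(\<integral>\<^sup>+x. f (Complex (t * y + x) y) \<partial>lborel) = (\<integral>\<^sup>+x. f (Complex x y) \<partial>lborel)"
      by (rule nn_integral_translate[where f = "\<lambda>x. f (Complex x y)"]) simp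
  qed
  finally show ?thesis
    by (simp add: nn_integral_complex_iterated(1))
qed

lemma nn_integral_shear_Im:
  fixes f :: "complex \<Rightarrow> ennreal"
  assumes [measurable]: "f \<in> borel_measurable borel"
  shows "(\<integral>\<^sup>+w. f (w + \<i> * of_real (t * Re w)) \<partial>lborel) = (\<integral>\<^sup>+w. f w \<partial>lborel)"
proof -
  have "(\<integral>\<^sup>+w. f (w + \<i> * of_real (t * Re w)) \<partial>lborel)
      = (\<integral>\<^sup>+x. \<integral>\<^sup>+y. f (Complex x (t * x + y)) \<partial>lborel \<partial>lborel)"
    by (subst nn_integral_complex_iterated(2)) (auto simp: complex_eq_iff intro!: nn_integral_cong arg_cong[of _ _ f])
  also have "\<dots> = (\<integral>\<^sup>+x. \<integral>\<^sup>+y. f (Complex x y) \<partial>lborel \<partial>lborel)"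
  proof (rule nn_integral_cong)
    fix x :: real
    have [measurable]: "(\<lambda>y. Complex x y) \<in> borel_measurable borel"
      by (simp add: Complex_eq)
    show "(\<integral>\<^sup>+y. f (Complex x (t * x + y)) \<partial>lborel) = (\<integral>\<^sup>+y. f (Complex x y) \<partial>lborel)"
      by (rule nn_integral_translate[where f = "\<lambda>y. f (Complex x y)"]) simp
  qed
  finally show ?thesis
    by (simp add: nn_integral_complex_iterated(2))
qed

text \<open>A plane rotation other than the half turn is a product of three shears.\<close>

lemma nn_integral_rotate:
  fixes f :: "complex \<Rightarrow> ennreal"
  assumes [measurable]: "f \<in> borel_measurable borel" and c: "cmod c = 1"
  shows "(\<integral>\<^sup>+w. f (c * w) \<partial>lborel) = (\<integral>\<^sup>+w. f w \<partial>lborel)"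
proof -
  have rot: "(\<integral>\<^sup>+w. h (c * w) \<partial>lborel) = (\<integral>\<^sup>+w. h w \<partial>lborel)"
    if [measurable]: "h \<in> borel_measurable borel" and c: "cmod c = 1" "Re c \<noteq> -1"
    for h :: "complex \<Rightarrow> ennreal" and c
  proof -
    \<comment> \<open>For c = cis \<theta> this is minus the tangent of \<theta> / 2; the half-angle
      identities \<open>st\<close> and \<open>tt\<close> then make \<open>S (R (S w))\<close> equal
      to \<open>c * w\<close>.\<close>
    define t where "t = - Im c / (1 + Re c)"
    define S where "S = (\<lambda>w. w + of_real (t * Im w))"
    define R where "R = (\<lambda>w. w + \<i> * of_real (Im c * Re w))"
    have [measurable]: "S \<in> borel_measurable borel" "R \<in> borel_measurable borel"
      unfolding S_def R_def by measurable
    have n: "Re c * Re c + Im c * Im c = 1"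
      using c(1) by (simp add: cmod_def power2_eq_square)
    have pos: "1 + Re c \<noteq> 0" using c(2) by linarith
    have st: "1 + Im c * t = Re c"
      using pos n by (simp add: t_def field_simps)
    have tt: "t * (1 + Re c) = - Im c"
      using pos by (simp add: t_def)
    have "c * w = S (R (S w))" for w
    proof -
      have "Im c * Re w + (1 + Im c * t) * Im w = Im (S (R (S w)))"
        by (simp add: S_def R_def algebra_simps)
      moreover have "(1 + Im c * t) * Re w + (t * (1 + (1 + Im c * t))) * Im w = Re (S (R (S w)))"
        by (simp add: S_def R_def algebra_simps)
      ultimately show ?thesis
        unfolding st tt by (simp add: complex_eq_iff)
    qed
    then have "(\<integral>\<^sup>+w. h (c * w) \<partial>lborel) = (\<integral>\<^sup>+w. h (S (R (S w))) \<partial>lborel)"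
      by simp
    also have "\<dots> = (\<integral>\<^sup>+w. h (S (R w)) \<partial>lborel)"
      using nn_integral_shear_Re[of "\<lambda>w. h (S (R w))" t] by (simp add: S_def)
    also have "\<dots> = (\<integral>\<^sup>+w. h (S w) \<partial>lborel)"
      using nn_integral_shear_Im[of "\<lambda>w. h (S w)" "Im c"] by (simp add: R_def)
    also have "\<dots> = (\<integral>\<^sup>+w. h w \<partial>lborel)"
      using nn_integral_shear_Re[of h t] by (simp add: S_def)
    finally show ?thesis .
  qed
  show ?thesis
  proof (cases "Re c = -1")
    case True
    \<comment> \<open>The half-angle tangent has a pole at the half turn, but that rotation is two
      quarter turns, each covered by \<open>rot\<close>.\<close>
    then have "c = \<i> * \<i>"
      using c by (auto simp: complex_eq_iff cmod_def)
    then show ?thesis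
      using rot[of f \<i>] rot[of "\<lambda>w. f (\<i> * w)" \<i>] by (simp add: mult.assoc)
  qed (use rot assms in auto)
qed

section \<open>Mean value inequalities\<close>

text \<open>Every rotation preserves both Lebesgue measure and \<open>A\<close>, so rotating the
  integrand does not change the integral. Average over the angle and exchange the integrals.\<close>

lemma nn_integral_circle_average:
  fixes H :: "complex \<Rightarrow> ennreal"
  assumes [measurable]: "H \<in> borel_measurable borel" "A \<in> sets borel"
    and A: "\<And>c w. cmod c = 1 \<Longrightarrow> c * w \<in> A \<longleftrightarrow> w \<in> A"
  shows "(\<integral>\<^sup>+w\<in>A. H w \<partial>lborel)
    = (\<integral>\<^sup>+w\<in>A. (\<integral>\<^sup>+t\<in>{0..1}. H (cis (2 * pi * t) * w) \<partial>lborel) \<partial>lborel)"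
proof -
  have [measurable]: "cis \<in> borel_measurable borel"
    by (intro borel_measurable_continuous_onI continuous_intros)
  have "(\<integral>\<^sup>+w\<in>A. (\<integral>\<^sup>+t\<in>{0..1}. H (cis (2 * pi * t) * w) \<partial>lborel) \<partial>lborel)
      = (\<integral>\<^sup>+w. \<integral>\<^sup>+t. H (cis (2 * pi * t) * w) * indicator {0..1} t * indicator A w \<partial>lborel \<partial>lborel)"
    by (simp add: nn_integral_multc)
  also have "\<dots> = (\<integral>\<^sup>+t. \<integral>\<^sup>+w. H (cis (2 * pi * t) * w) * indicator {0..1} t * indicator A w \<partial>lborel \<partial>lborel)"
    by (rule lborel_pair.Fubini') simp
  also have "\<dots> = (\<integral>\<^sup>+t. (\<integral>\<^sup>+w. H w * indicator A w \<partial>lborel) * indicator {0..1::real} t \<partial>lborel)"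
  proof (rule nn_integral_cong)
    fix t :: real
    have "(\<integral>\<^sup>+w. H (cis (2 * pi * t) * w) * indicator A (cis (2 * pi * t) * w) \<partial>lborel)
        = (\<integral>\<^sup>+w. H w * indicator A w \<partial>lborel)"
      by (rule nn_integral_rotate[where f = "\<lambda>w. H w * indicator A w"]) auto
    moreover have "indicator A (cis (2 * pi * t) * w) = (indicator A w :: ennreal)" for w
      by (simp add: A indicator_def)
    ultimately show "(\<integral>\<^sup>+w. H (cis (2 * pi * t) * w) * indicator {0..1} t * indicator A w \<partial>lborel)
        = (\<integral>\<^sup>+w. H w * indicator A w \<partial>lborel) * indicator {0..1} t"
      by (cases "t \<in> {0..1}") (simp_all add: mult_ac)
  qed
  also have "\<dots> = (\<integral>\<^sup>+w\<in>A. H w \<partial>lborel)"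
    by (simp add: nn_integral_cmult_indicator)
  finally show ?thesis by simp
qed

text \<open>Integrate the circle bound over the radii. The rotation-invariant set \<open>A\<close>
  is left general because the value of a function is estimated on a disc, but its derivative on an
  annulus.\<close>

lemma circle_bound_imp_area_bound:
  fixes H :: "complex \<Rightarrow> ennreal"
  assumes [measurable]: "H \<in> borel_measurable borel" "A \<in> sets borel"
    and A: "\<And>c w. cmod c = 1 \<Longrightarrow> c * w \<in> A \<longleftrightarrow> w \<in> A" "A \<subseteq> ball 0 R"
    and k: "\<And>w. w \<in> A \<Longrightarrow> k \<le> (\<integral>\<^sup>+t\<in>{0..1}. H (x + cis (2 * pi * t) * w) \<partial>lborel)"
  shows "k * emeasure lborel A \<le> (\<integral>\<^sup>+w\<in>ball x R. H w \<partial>lborel)"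
proof -
  have [measurable]: "ball x R \<in> sets borel"
    by simp
  have "k * emeasure lborel A = (\<integral>\<^sup>+w\<in>A. k \<partial>lborel)"
    by (simp add: nn_integral_cmult_indicator)
  also have "\<dots> \<le> (\<integral>\<^sup>+w\<in>A. (\<integral>\<^sup>+t\<in>{0..1}. H (x + cis (2 * pi * t) * w) \<partial>lborel) \<partial>lborel)"
    by (intro nn_integral_mono) (auto split: split_indicator dest: k)
  also have "\<dots> = (\<integral>\<^sup>+w\<in>A. H (x + w) \<partial>lborel)"
    by (rule nn_integral_circle_average[symmetric]) (auto simp: A)
  also have "\<dots> \<le> (\<integral>\<^sup>+w. H (x + w) * indicator (ball x R) (x + w) \<partial>lborel)"
    using A(2) by (intro nn_integral_mono) (auto split: split_indicator simp: dist_norm)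
  also have "\<dots> = (\<integral>\<^sup>+w\<in>ball x R. H w \<partial>lborel)"
    by (rule nn_integral_translate[where f = "\<lambda>w. H w * indicator (ball x R) w"]) measurable
  finally show ?thesis .
qed

lemma norm_has_integral_le_nn_integral:
  fixes f :: "real \<Rightarrow> complex"
  assumes I: "(f has_integral I) {a..b}" and c: "continuous_on {a..b} f"
  shows "ennreal (cmod I) \<le> (\<integral>\<^sup>+t\<in>{a..b}. cmod (f t) \<partial>lborel)"
proof -
  have n: "(\<lambda>t. cmod (f t)) integrable_on {a..b}"
    using c by (intro integrable_continuous_real continuous_intros)
  have "cmod I \<le> integral {a..b} (\<lambda>t. cmod (f t))"
    using integral_norm_bound_integral[OF _ n] I by (auto simp: has_integral_iff)
  also have "ennreal \<dots> = (\<integral>\<^sup>+t\<in>{a..b}. cmod (f t) \<partial>lborel)"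
    using nn_integral_has_integral_lebesgue'[OF _ integrable_integral[OF n]] by simp
  finally show ?thesis
    by (simp add: ennreal_leI)
qed

text \<open>Cauchy's formulas for the value and the derivative at 0 of
  \<open>\<zeta> \<mapsto> f (x + \<zeta> * w)\<close> on the unit circle. The chain rule produces
  the factor \<open>w\<close>, and 1 / \<zeta> is the conjugate of \<zeta> there.\<close>

lemma entire_circle_mean:
  assumes f: "f holomorphic_on UNIV"
  shows "((\<lambda>t. f (x + cis (2 * pi * t) * w)) has_integral f x) {0..1}"
    and "((\<lambda>t. f (x + cis (2 * pi * t) * w) * cnj (cis (2 * pi * t))) has_integral w * deriv f x) {0..1}"
proof -
  define F where "F = (\<lambda>\<zeta>. f (x + \<zeta> * w))"
  have F: "F holomorphic_on S" for S
    unfolding F_def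
    by (rule holomorphic_on_compose_gen[where g = f and t = UNIV and f = "\<lambda>\<zeta>. x + \<zeta> * w", unfolded o_def])
       (auto intro!: holomorphic_intros f)
  have e: "exp (2 * of_real pi * \<i> * of_real t) = cis (2 * pi * t)" for t
    by (simp add: cis_conv_exp mult_ac)
  have pt: "circlepath 0 1 t = cis (2 * pi * t)" for t
    by (simp add: circlepath e)
  \<comment> \<open>The exponents \<open>k = 1\<close> and \<open>k = 2\<close> give the value and
    the derivative, respectively.\<close>
  have eq: "((\<lambda>t. F (cis (2 * pi * t)) / cis (2 * pi * t) ^ k * (2 * pi * \<i> * cis (2 * pi * t))) has_integral I) {0..1}"
    if "((\<lambda>u. F u / u ^ k) has_contour_integral I) (circlepath 0 1)" for k I
  proof -
    have "((\<lambda>t. F (circlepath 0 1 t) / circlepath 0 1 t ^ k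
        * vector_derivative (circlepath 0 1) (at t within {0..1})) has_integral I) {0..1}"
      using that by (simp add: has_contour_integral_def)
    then show ?thesis
      by (rule has_integral_eq[rotated]) (auto simp: vector_derivative_circlepath01 pt e)
  qed
  have d: "deriv F 0 = w * deriv f x"
  proof -
    have "(f has_field_derivative deriv f x) (at (x + 0 * w))"
      using holomorphic_derivI[OF f] by simp
    then have "((\<lambda>\<zeta>. f (x + \<zeta> * w)) has_field_derivative deriv f x * w) (at 0)"
      by (rule DERIV_chain2) (auto intro!: derivative_eq_intros)
    then show ?thesis
      by (auto simp: F_def mult.commute intro!: DERIV_imp_deriv)
  qed
  have z: "2 * of_real pi * \<i> \<noteq> (0 :: complex)" by simp
  have "((\<lambda>u. F u / u ^ 1) has_contour_integral 2 * pi * \<i> * F 0) (circlepath 0 1)"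
    using Cauchy_integral_circlepath_simple[of F 0 1 0] F by simp
  from has_integral_mult_right[OF eq[OF this], of "1 / (2 * of_real pi * \<i>)"]
  show "((\<lambda>t. f (x + cis (2 * pi * t) * w)) has_integral f x) {0..1}"
    by (simp add: F_def)
  have "((\<lambda>u. F u / u ^ 2) has_contour_integral 2 * pi * \<i> * deriv F 0) (circlepath 0 1)"
    using Cauchy_has_contour_integral_higher_derivative_circlepath[of 0 1 F 0 1] F
    by (simp add: holomorphic_on_imp_continuous_on eval_nat_numeral)
  from has_integral_mult_right[OF eq[OF this], of "1 / (2 * of_real pi * \<i>)"]
  show "((\<lambda>t. f (x + cis (2 * pi * t) * w) * cnj (cis (2 * pi * t))) has_integral w * deriv f x) {0..1}"
    by (simp add: F_def d[unfolded F_def] power2_eq_square cis_cnj divide_simps flip: cis_mult cis_inverse)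
qed

lemma cnj_has_integral: "(f has_integral I) S \<Longrightarrow> ((\<lambda>t. cnj (f t)) has_integral cnj I) S"
  using has_integral_linear[of f I S cnj] bounded_linear_cnj by (simp add: o_def)

text \<open>Multiplying by the conjugate of \<zeta> = cis (2 pi t) isolates \<open>g\<close>: the
  other summand becomes the conjugate of \<open>h (x + \<zeta> * w) * \<zeta>\<close>, which is
  entire in \<zeta> and vanishes at 0, so its mean is zero.\<close>

lemma harmonic_circle_mean:
  assumes g: "g holomorphic_on UNIV" and h: "h holomorphic_on UNIV"
  defines "u \<equiv> \<lambda>z. g z + cnj (h z)"
  shows "((\<lambda>t. u (x + cis (2 * pi * t) * w)) has_integral u x) {0..1}"
    and "((\<lambda>t. u (x + cis (2 * pi * t) * w) * cnj (cis (2 * pi * t))) has_integral w * deriv g x) {0..1}"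
proof -
  show "((\<lambda>t. u (x + cis (2 * pi * t) * w)) has_integral u x) {0..1}"
    unfolding u_def
    by (intro has_integral_add cnj_has_integral entire_circle_mean g h)
  have "((\<lambda>t. h (x + cis (2 * pi * t) * w) * cis (2 * pi * t)) has_integral 0) {0..1}"
  proof -
    have "(\<lambda>\<zeta>. h (x + \<zeta> * w)) holomorphic_on UNIV"
      by (rule holomorphic_on_compose_gen[where g = h and t = UNIV and f = "\<lambda>\<zeta>. x + \<zeta> * w", unfolded o_def])
         (auto intro!: holomorphic_intros h)
    then have "(\<lambda>\<zeta>. h (x + \<zeta> * w) * \<zeta>) holomorphic_on UNIV"
      by (intro holomorphic_intros)
    from entire_circle_mean(1)[OF this, of 0 1] show ?thesis by simp
  qed
  from has_integral_add[OF entire_circle_mean(2)[OF g, of x w] cnj_has_integral[OF this]]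
  show "((\<lambda>t. u (x + cis (2 * pi * t) * w) * cnj (cis (2 * pi * t))) has_integral w * deriv g x) {0..1}"
    by (simp add: u_def distrib_right)
qed

lemma emeasure_lborel_ball_complex: "r \<ge> 0 \<Longrightarrow> emeasure lborel (ball (x :: complex) r) = ennreal (pi * r\<^sup>2)"
  by (simp add: emeasure_ball unit_ball_vol_2)

lemma harmonic_area_bounds:
  assumes g: "g holomorphic_on UNIV" and h: "h holomorphic_on UNIV" and R: "R > 0"
  defines "u \<equiv> \<lambda>z. g z + cnj (h z)"
  shows "ennreal (cmod (u x)) * ennreal (pi * R\<^sup>2) \<le> (\<integral>\<^sup>+w\<in>ball x R. cmod (u w) \<partial>lborel)"
    and "ennreal (cmod (deriv g x)) * ennreal (3 / 8 * pi * R ^ 3) \<le> (\<integral>\<^sup>+w\<in>ball x R. cmod (u w) \<partial>lborel)"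
proof -
  have u: "continuous_on S u" for S
    unfolding u_def using g h
    by (intro continuous_intros holomorphic_on_imp_continuous_on) (auto elim: holomorphic_on_subset)
  have [measurable]: "u \<in> borel_measurable borel"
    by (intro borel_measurable_continuous_onI u)
  have uc: "continuous_on {0..1} (\<lambda>t. u (x + cis (2 * pi * t) * w))" for w
    by (intro continuous_intros continuous_on_compose2[OF u[of UNIV]]) auto
  have "ennreal (cmod (u x)) \<le> (\<integral>\<^sup>+t\<in>{0..1}. cmod (u (x + cis (2 * pi * t) * w)) \<partial>lborel)" for w
    using norm_has_integral_le_nn_integral[OF _ uc] harmonic_circle_mean(1)[OF g h] u_def by blast
  then have "ennreal (cmod (u x)) * emeasure lborel (ball (0 :: complex) R) \<le> (\<integral>\<^sup>+w\<in>ball x R. cmod (u w) \<partial>lborel)"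
    by (intro circle_bound_imp_area_bound) (auto simp: norm_mult)
  then show "ennreal (cmod (u x)) * ennreal (pi * R\<^sup>2) \<le> (\<integral>\<^sup>+w\<in>ball x R. cmod (u w) \<partial>lborel)"
    using R by (simp add: emeasure_lborel_ball_complex)
  \<comment> \<open>The circle mean yields \<open>w * deriv g x\<close>, so \<open>w\<close> has to
    stay away from 0. On this annulus its modulus is at least R / 2 and the area is 3/4 pi R^2; the
    product of the two is the constant 3/8 pi R^3.\<close>
  define A where "A = ball (0 :: complex) R - ball 0 (R / 2)"
  have "ennreal (cmod (deriv g x) * (R / 2)) \<le> (\<integral>\<^sup>+t\<in>{0..1}. cmod (u (x + cis (2 * pi * t) * w)) \<partial>lborel)"
    if "w \<in> A" for w
  proof -
    have deriv_mean: "((\<lambda>t. u (x + cis (2 * pi * t) * w) * cnj (cis (2 * pi * t))) has_integral w * deriv g x) {0..1}"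
      unfolding u_def by (rule harmonic_circle_mean(2)[OF g h])
    have "ennreal (cmod (deriv g x) * (R / 2)) \<le> ennreal (cmod (w * deriv g x))"
      using that mult_right_mono[of "R / 2" "cmod w" "cmod (deriv g x)"]
      by (intro ennreal_leI) (auto simp: A_def norm_mult mult.commute)
    also have "\<dots> \<le> (\<integral>\<^sup>+t\<in>{0..1}. cmod (u (x + cis (2 * pi * t) * w) * cnj (cis (2 * pi * t))) \<partial>lborel)"
      by (rule norm_has_integral_le_nn_integral[OF deriv_mean]) (intro continuous_intros uc)
    finally show ?thesis
      by (simp add: norm_mult)
  qed
  then have "ennreal (cmod (deriv g x) * (R / 2)) * emeasure lborel A \<le> (\<integral>\<^sup>+w\<in>ball x R. cmod (u w) \<partial>lborel)"
    by (intro circle_bound_imp_area_bound) (auto simp: norm_mult A_def)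
  moreover have "emeasure lborel A = ennreal (3 / 4 * pi * R\<^sup>2)"
  proof -
    have "emeasure lborel A = ennreal (pi * R\<^sup>2) - ennreal (pi * (R / 2)\<^sup>2)"
      unfolding A_def using R
      by (subst emeasure_Diff) (auto simp: emeasure_lborel_ball_complex)
    also have "\<dots> = ennreal (3 / 4 * pi * R\<^sup>2)"
      using R by (subst ennreal_minus) (auto simp: power2_eq_square mult_ac)
    finally show ?thesis .
  qed
  moreover have "ennreal (cmod (deriv g x) * (R / 2)) * ennreal (3 / 4 * pi * R\<^sup>2)
      = ennreal (cmod (deriv g x)) * ennreal (3 / 8 * pi * R ^ 3)"
    using R by (simp add: ennreal_mult[symmetric] power2_eq_square power3_eq_cube algebra_simps)
  ultimately show "ennreal (cmod (deriv g x)) * ennreal (3 / 8 * pi * R ^ 3) \<le> (\<integral>\<^sup>+w\<in>ball x R. cmod (u w) \<partial>lborel)"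
    by simp
qed

section \<open>Weighted estimates in one complex variable\<close>

text \<open>The holomorphic function \<open>g' exp (- a w)\<close> obeys the mean value inequality at a scale independent
  of \<open>a\<close>; only the passage from \<open>u\<close> to \<open>g'\<close> uses the small scale \<open>1 / (\<bar>a\<bar> + 4)\<close>, on which the weight
  is essentially constant, and it costs just one factor \<open>\<bar>a\<bar> + 4\<close>.\<close>

lemma harmonic_weighted_deriv_bound:
  fixes a :: complex
  assumes g: "g holomorphic_on UNIV" and h: "h holomorphic_on UNIV"
  defines "u \<equiv> \<lambda>z. g z + cnj (h z)"
  shows "ennreal (cmod (deriv g x * exp (- a * x)))
    \<le> ennreal (128 * exp 1 / (3 * pi) * (cmod a + 4)) * (\<integral>\<^sup>+w\<in>ball x (1 / 2). cmod (u w * exp (- a * w)) \<partial>lborel)"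
proof -
  \<comment> \<open>The summand \<open>cmod a\<close> keeps the oscillation of Re (a w) on balls of
    radius \<open>s\<close> at most 1, at the cost of a factor \<open>exp 1\<close>. The summand 4
    makes s <= 1/4, so that such balls around points of \<open>ball x (1 / 4)\<close> stay inside
    \<open>ball x (1 / 2)\<close>.\<close>
  define s where "s = 1 / (cmod a + 4)"
  have s: "0 < s" "s \<le> 1 / 4" "cmod a * s \<le> 1"
    by (auto simp: s_def field_simps add_nonneg_pos)
  define G where "G = (\<lambda>w. deriv g w * exp (- a * w))"
  define H where "H = (\<lambda>w. cmod (u w * exp (- a * w)))"
  define c where "c = 3 / 8 * pi * s ^ 3"
  have c: "c > 0" using s by (simp add: c_def)
  have G: "G holomorphic_on UNIV"
    unfolding G_def using g by (auto intro!: holomorphic_intros)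
  have u: "continuous_on S u" for S
    unfolding u_def using g h
    by (intro continuous_intros holomorphic_on_imp_continuous_on) (auto elim: holomorphic_on_subset)
  have [measurable]: "u \<in> borel_measurable borel" "H \<in> borel_measurable borel" "G \<in> borel_measurable borel"
    unfolding H_def
    by (intro borel_measurable_continuous_onI continuous_intros u holomorphic_on_imp_continuous_on G)+
  have [measurable]: "{p :: complex \<times> complex. dist (fst p) (snd p) < s} \<in> sets borel"
    by (intro borel_open open_Collect_less continuous_intros)
  have [measurable]: "Measurable.pred (borel \<Otimes>\<^sub>M borel) (\<lambda>p :: complex \<times> complex. dist (fst p) (snd p) < s)"
    by measurable
  have [measurable]: "(ball y r :: complex set) \<in> sets borel" for y r by simp
  have small: "ennreal (cmod (G w)) * ennreal c \<le> ennreal (exp 1) * (\<integral>\<^sup>+y\<in>ball w s. H y \<partial>lborel)" for w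
  proof -
    have "ennreal (cmod (G w)) * ennreal c = ennreal (cmod (exp (- a * w))) * (ennreal (cmod (deriv g w)) * ennreal c)"
      by (simp add: G_def norm_mult ennreal_mult mult_ac)
    also have "\<dots> \<le> ennreal (cmod (exp (- a * w))) * (\<integral>\<^sup>+y\<in>ball w s. cmod (u y) \<partial>lborel)"
      using harmonic_area_bounds(2)[OF g h s(1), of w] by (intro mult_left_mono) (auto simp: u_def c_def)
    also have "\<dots> = (\<integral>\<^sup>+y\<in>ball w s. ennreal (cmod (exp (- a * w)) * cmod (u y)) \<partial>lborel)"
      by (subst nn_integral_cmult[symmetric]) (auto simp: ennreal_mult mult_ac)
    also have "\<dots> \<le> (\<integral>\<^sup>+y\<in>ball w s. ennreal (exp 1 * H y) \<partial>lborel)"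
    proof (intro nn_integral_mono)
      fix y
      have "cmod (exp (- a * w)) * cmod (u y) \<le> exp 1 * H y" if "y \<in> ball w s"
      proof -
        have "cmod (a * (y - w)) \<le> cmod a * s"
          using that by (auto simp: norm_mult dist_norm norm_minus_commute intro!: mult_left_mono)
        then have "Re (a * (y - w)) \<le> 1"
          using s(3) complex_Re_le_cmod[of "a * (y - w)"] by linarith
        then have "cmod (exp (- a * w)) \<le> exp 1 * cmod (exp (- a * y))"
          by (simp add: norm_exp_eq_Re algebra_simps flip: exp_add)
        then show ?thesis
          using mult_right_mono[of _ _ "cmod (u y)"] by (force simp: H_def norm_mult mult_ac)
      qed
      then show "ennreal (cmod (exp (- a * w)) * cmod (u y)) * indicator (ball w s) y
          \<le> ennreal (exp 1 * H y) * indicator (ball w s) y"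
        by (auto split: split_indicator intro!: ennreal_leI)
    qed
    also have "\<dots> = ennreal (exp 1) * (\<integral>\<^sup>+y\<in>ball w s. H y \<partial>lborel)"
      by (subst nn_integral_cmult[symmetric]) (auto simp: ennreal_mult mult_ac H_def)
    finally show ?thesis .
  qed
  have "ennreal (cmod (G x)) * ennreal (pi / 16) * ennreal c \<le> (\<integral>\<^sup>+w\<in>ball x (1 / 4). cmod (G w) \<partial>lborel) * ennreal c"
    using harmonic_area_bounds(1)[OF G, of "\<lambda>_. 0" "1 / 4" x]
    by (intro mult_right_mono) (auto simp: power2_eq_square)
  also have "\<dots> = (\<integral>\<^sup>+w\<in>ball x (1 / 4). ennreal (cmod (G w)) * ennreal c \<partial>lborel)"
    by (subst nn_integral_multc[symmetric]) (auto simp: mult_ac)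
  also have "\<dots> \<le> (\<integral>\<^sup>+w\<in>ball x (1 / 4). ennreal (exp 1) * (\<integral>\<^sup>+y\<in>ball w s. H y \<partial>lborel) \<partial>lborel)"
    by (intro nn_integral_mono) (auto split: split_indicator intro: small)
  \<comment> \<open>Tonelli's theorem: a fixed y is counted only for w in the ball of radius
    \<open>s\<close> around it. The area pi s^2 of that ball cancels two of the three powers of
    \<open>s\<close> in \<open>c\<close>, and only 1 / s = \<open>cmod a + 4\<close> is
    lost.\<close>
  also have "\<dots> = (\<integral>\<^sup>+w. \<integral>\<^sup>+y. ennreal (exp 1) * ennreal (H y) * indicator (ball x (1 / 4)) w * (if dist w y < s then 1 else 0) \<partial>lborel \<partial>lborel)"
    by (intro nn_integral_cong) (auto simp: indicator_def nn_integral_cmult[symmetric] intro!: nn_integral_cong)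
  also have "\<dots> = (\<integral>\<^sup>+y. \<integral>\<^sup>+w. ennreal (exp 1) * ennreal (H y) * indicator (ball x (1 / 4)) w * (if dist w y < s then 1 else 0) \<partial>lborel \<partial>lborel)"
    by (rule lborel_pair.Fubini') measurable
  also have "\<dots> \<le> (\<integral>\<^sup>+y. \<integral>\<^sup>+w. (ennreal (exp 1) * ennreal (H y) * indicator (ball x (1 / 2)) y) * indicator (ball y s) w \<partial>lborel \<partial>lborel)"
  proof (intro nn_integral_mono)
    fix y w
    have "dist x y < 1 / 2" if "dist x w < 1 / 4" "dist w y < s"
      using dist_triangle[of x y w] that s(2) by linarith
    then show "ennreal (exp 1) * ennreal (H y) * indicator (ball x (1 / 4)) w * (if dist w y < s then 1 else 0)
        \<le> ennreal (exp 1) * ennreal (H y) * indicator (ball x (1 / 2)) y * indicator (ball y s) w"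
      by (auto split: split_indicator simp: dist_commute)
  qed
  also have "\<dots> = (\<integral>\<^sup>+y. ennreal (exp 1 * (pi * s\<^sup>2)) * (ennreal (H y) * indicator (ball x (1 / 2)) y) \<partial>lborel)"
  proof (rule nn_integral_cong)
    fix y
    have "(\<integral>\<^sup>+w. (ennreal (exp 1) * ennreal (H y) * indicator (ball x (1 / 2)) y) * indicator (ball y s) w \<partial>lborel)
        = (ennreal (exp 1) * ennreal (H y) * indicator (ball x (1 / 2)) y) * emeasure lborel (ball y s)"
      by (rule nn_integral_cmult_indicator) simp
    then show "(\<integral>\<^sup>+w. (ennreal (exp 1) * ennreal (H y) * indicator (ball x (1 / 2)) y) * indicator (ball y s) w \<partial>lborel)
        = ennreal (exp 1 * (pi * s\<^sup>2)) * (ennreal (H y) * indicator (ball x (1 / 2)) y)"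
      using s by (simp add: emeasure_lborel_ball_complex ennreal_mult mult_ac)
  qed
  also have "\<dots> = ennreal (exp 1 * (pi * s\<^sup>2)) * (\<integral>\<^sup>+y\<in>ball x (1 / 2). H y \<partial>lborel)"
    by (rule nn_integral_cmult) measurable
  also have "ennreal (cmod (G x)) * ennreal (pi / 16) * ennreal c = ennreal (cmod (G x)) * ennreal (pi / 16 * c)"
    using c ennreal_mult[of "pi / 16" c] by (simp add: mult.assoc)
  finally have main: "ennreal (cmod (G x)) * ennreal (pi / 16 * c)
      \<le> ennreal (exp 1 * (pi * s\<^sup>2)) * (\<integral>\<^sup>+y\<in>ball x (1 / 2). H y \<partial>lborel)" .
  define d where "d = 1 / (pi / 16 * c)"
  have d: "d \<ge> 0" using c by (simp add: d_def)
  have "ennreal (cmod (G x)) = ennreal (cmod (G x)) * ennreal (pi / 16 * c) * ennreal d"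
    using c d by (simp add: d_def ennreal_mult[symmetric])
  also have "\<dots> \<le> ennreal (exp 1 * (pi * s\<^sup>2)) * (\<integral>\<^sup>+y\<in>ball x (1 / 2). H y \<partial>lborel) * ennreal d"
    by (rule mult_right_mono[OF main]) simp
  also have "\<dots> = ennreal (exp 1 * (pi * s\<^sup>2) * d) * (\<integral>\<^sup>+y\<in>ball x (1 / 2). H y \<partial>lborel)"
    using s d by (simp add: ennreal_mult mult_ac)
  also have "exp 1 * (pi * s\<^sup>2) * d = 128 * exp 1 / (3 * pi) * (cmod a + 4)"
  proof -
    have "cmod a + 4 = 1 / s" by (simp add: s_def)
    show ?thesis
      unfolding \<open>cmod a + 4 = 1 / s\<close> using s(1) by (simp add: d_def c_def field_simps power2_eq_square power3_eq_cube)
  qed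
  finally show ?thesis
    by (simp add: G_def H_def)
qed

text \<open>Move from \<open>0\<close> against the direction in which the weight decays: the weight at \<open>- e / 2\<close> is at least
  \<open>1\<close>, and the derivative bound along the way is integrable uniformly in \<open>a\<close>.\<close>

lemma harmonic_weighted_mean_bound:
  fixes a :: complex
  assumes g: "g holomorphic_on UNIV" and h: "h holomorphic_on UNIV"
  defines "u \<equiv> \<lambda>z. g z + cnj (h z)"
  shows "ennreal (cmod (u 0))
    \<le> ennreal (256 * exp 1 / pi + 16 / pi) * (\<integral>\<^sup>+w\<in>ball 0 1. cmod (u w * exp (- a * w)) \<partial>lborel)"
proof (cases "(\<integral>\<^sup>+w\<in>ball 0 1. cmod (u w * exp (- a * w)) \<partial>lborel) = \<infinity>")
  case True
  then show ?thesis
    by (simp add: ennreal_mult_top add_pos_pos)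
next
  case False
  define H where "H = (\<lambda>w. cmod (u w * exp (- a * w)))"
  \<comment> \<open>With the infinite case removed the weighted integral is a real number, as the
    mean value inequality on the segment requires.\<close>
  define I where "I = enn2real (\<integral>\<^sup>+w\<in>ball 0 1. H w \<partial>lborel)"
  have I: "(\<integral>\<^sup>+w\<in>ball 0 1. H w \<partial>lborel) = ennreal I" "I \<ge> 0"
    using False by (auto simp: I_def H_def ennreal_enn2real_if)
  define K where "K = 128 * exp 1 / (3 * pi)"
  have K: "K > 0" by (simp add: K_def)
  define A where "A = cmod a"
  \<comment> \<open>The unit vector along which Re (a w) grows fastest; for \<open>a = 0\<close> any
    unit vector serves.\<close>
  define e where "e = (if a = 0 then 1 else cnj a / cmod a)"
  have e: "cmod e = 1" "a * e = of_real A"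
    by (auto simp: e_def A_def norm_divide complex_norm_square[symmetric] power2_eq_square)
  have sub: "(\<integral>\<^sup>+w\<in>ball x (1 / 2). H w \<partial>lborel) \<le> ennreal I" if "cmod x \<le> 1 / 2" for x
  proof -
    have "ball x (1 / 2) \<subseteq> ball 0 1"
      using that by (subst ball_subset_ball_iff) auto
    then have "(\<integral>\<^sup>+w\<in>ball x (1 / 2). H w \<partial>lborel) \<le> (\<integral>\<^sup>+w\<in>ball 0 1. H w \<partial>lborel)"
      by (intro nn_integral_mono) (auto split: split_indicator)
    then show ?thesis using I by simp
  qed
  \<comment> \<open>Stated for a general pair because it is used twice: for \<open>g\<close> with
    \<open>u\<close>, and for \<open>h\<close> with the conjugate of \<open>u\<close>, in which the
    two functions swap roles.\<close>
  have bnd: "cmod (deriv f (of_real t * e)) \<le> K * (A + 4) * I * exp (A * t)"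
    if t: "-1 / 2 \<le> t" "t \<le> 0" and f: "f holomorphic_on UNIV" "k holomorphic_on UNIV"
      and H: "\<And>w. cmod (f w + cnj (k w)) = cmod (u w)" for f k t
  proof -
    define x where "x = of_real t * e"
    have x: "cmod x \<le> 1 / 2" using t e by (simp add: x_def norm_mult)
    have ax: "- (a * x) = of_real (- A * t)"
      using e(2) by (simp add: x_def mult_ac)
    have "ennreal (cmod (deriv f x * exp (- a * x))) \<le> ennreal (K * (A + 4)) * (\<integral>\<^sup>+w\<in>ball x (1 / 2). H w \<partial>lborel)"
      using harmonic_weighted_deriv_bound[OF f, of x a] by (simp add: K_def A_def H_def norm_mult H)
    also have "\<dots> \<le> ennreal (K * (A + 4)) * ennreal I"
      by (intro mult_left_mono sub x) simp
    also have "\<dots> = ennreal (K * (A + 4) * I)"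
      using K I by (simp add: ennreal_mult A_def)
    finally have "cmod (deriv f x * exp (- a * x)) \<le> K * (A + 4) * I"
      using K I by (subst (asm) ennreal_le_iff) (auto simp: A_def)
    moreover have "cmod (exp (- a * x)) = exp (- A * t)"
      using ax by (simp add: norm_exp_eq_Re)
    ultimately have "cmod (deriv f x) * exp (- A * t) \<le> K * (A + 4) * I"
      by (simp add: norm_mult)
    from mult_right_mono[OF this, of "exp (A * t)"] show ?thesis
      by (simp add: x_def mult.assoc flip: exp_add)
  qed
  define U where "U = (\<lambda>t. u (of_real t * e))"
  \<comment> \<open>A primitive of the derivative bound after \<open>exp (A * t)\<close> is replaced
    by 1 in the term with the 4. Its increment over [-1/2, 0] is at most 6 K I whatever
    \<open>A\<close> is, since the factor \<open>A\<close> disappears on integrating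
    \<open>A * exp (A * t)\<close>. Here 6 K = 256 exp 1 / pi.\<close>
  define \<phi> where "\<phi> = (\<lambda>t. 2 * K * I * (exp (A * t) + 4 * t))"
  have dU: "(U has_vector_derivative deriv g (of_real t * e) * e + cnj (deriv h (of_real t * e) * e)) (at t)" for t :: real
  proof -
    have "((\<lambda>t. f (of_real t * e)) has_vector_derivative deriv f (of_real t * e) * e) (at t)"
      if "f holomorphic_on UNIV" for f
    proof -
      have "((\<lambda>\<zeta>. f (\<zeta> * e)) has_field_derivative deriv f (of_real t * e) * e) (at (of_real t))"
        by (rule DERIV_chain2) (auto intro!: derivative_eq_intros holomorphic_derivI[OF that])
      then show ?thesis
        by (rule has_vector_derivative_real_field)
    qed
    then show ?thesis
      unfolding U_def u_def using g h
      by (intro has_vector_derivative_add has_vector_derivative_cnj) auto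
  qed
  have "cmod (U 0 - U (-1 / 2)) \<le> \<phi> 0 - \<phi> (-1 / 2)"
  proof (rule differentiable_bound_general[where \<phi>' = "\<lambda>t. 2 * K * I * (exp (A * t) * A + 4)"])
    show "continuous_on {-1 / 2..0} U"
      by (rule continuous_at_imp_continuous_on) (use dU in \<open>auto intro: has_vector_derivative_continuous\<close>)
    show "continuous_on {-1 / 2..0} \<phi>"
      unfolding \<phi>_def by (intro continuous_intros)
    fix t :: real assume t: "-1 / 2 < t" "t < 0"
    show "(\<phi> has_vector_derivative 2 * K * I * (exp (A * t) * A + 4)) (at t)"
      unfolding \<phi>_def has_real_derivative_iff_has_vector_derivative[symmetric]
      by (auto intro!: derivative_eq_intros)
    have "cmod (deriv g (of_real t * e) * e + cnj (deriv h (of_real t * e) * e))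
        \<le> cmod (deriv g (of_real t * e)) + cmod (deriv h (of_real t * e))"
      using norm_triangle_ineq[of "deriv g (of_real t * e) * e" "cnj (deriv h (of_real t * e) * e)"]
      by (simp add: norm_mult e)
    also have "\<dots> \<le> K * (A + 4) * I * exp (A * t) + K * (A + 4) * I * exp (A * t)"
    proof (intro add_mono bnd)
      show "cmod (h w + cnj (g w)) = cmod (u w)" for w
        using complex_mod_cnj[of "u w"] by (simp add: u_def add.commute)
    qed (use t g h in \<open>auto simp: u_def\<close>)
    also have "\<dots> = 2 * K * I * (exp (A * t) * A + 4 * exp (A * t))"
      by (simp add: algebra_simps)
    also have "\<dots> \<le> 2 * K * I * (exp (A * t) * A + 4)"
      using t K I(2) by (intro mult_left_mono add_left_mono) (auto simp: A_def mult_nonneg_nonpos)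
    finally show "cmod (deriv g (of_real t * e) * e + cnj (deriv h (of_real t * e) * e))
        \<le> 2 * K * I * (exp (A * t) * A + 4)" .
    show "(U has_vector_derivative deriv g (of_real t * e) * e + cnj (deriv h (of_real t * e) * e)) (at t)"
      by (rule dU)
  qed simp
  also have "\<phi> 0 - \<phi> (-1 / 2) \<le> 2 * K * I * 3"
    using K I(2) unfolding \<phi>_def right_diff_distrib[symmetric] by (intro mult_left_mono) auto
  finally have near: "cmod (U 0 - U (-1 / 2)) \<le> 6 * K * I" by simp
  \<comment> \<open>Within distance 1/4 of this point, Re (a w) <= A / 4 - A / 2 <= 0. The weight is
    therefore at least 1 on a whole ball, of area pi / 16, and the unweighted mean value inequality
    applies.\<close>
  define x where "x = - (e / 2)"
  have "ennreal (cmod (u x)) * ennreal (pi / 16) \<le> (\<integral>\<^sup>+w\<in>ball x (1 / 4). cmod (u w) \<partial>lborel)"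
    using harmonic_area_bounds(1)[OF g h, of "1 / 4" x] by (simp add: u_def power2_eq_square)
  also have "\<dots> \<le> (\<integral>\<^sup>+w\<in>ball x (1 / 2). H w \<partial>lborel)"
  proof (intro nn_integral_mono)
    fix w
    have "cmod (u w) \<le> H w" if "dist x w < 1 / 4"
    proof -
      have "cmod (a * (w - x)) \<le> A * (1 / 4)"
        using that unfolding norm_mult A_def
        by (intro mult_left_mono) (auto simp: dist_norm norm_minus_commute)
      then have "Re (a * (w - x)) \<le> A / 4"
        using complex_Re_le_cmod[of "a * (w - x)"] by linarith
      moreover have "a * w = a * (w - x) - of_real (A / 2)"
        using e(2) by (simp add: x_def algebra_simps)
      then have "Re (a * w) = Re (a * (w - x)) - A / 2"
        by (metis minus_complex.simps(1) Re_complex_of_real)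
      moreover have "A \<ge> 0"
        by (simp add: A_def)
      ultimately have "Re (a * w) \<le> 0"
        by linarith
      then have "Re (- a * w) \<ge> 0"
        by simp
      then have "1 \<le> cmod (exp (- a * w))"
        unfolding norm_exp_eq_Re by simp
      then show ?thesis
        unfolding H_def norm_mult using mult_left_mono[of 1 _ "cmod (u w)"] by simp
    qed
    then show "ennreal (cmod (u w)) * indicator (ball x (1 / 4)) w \<le> ennreal (H w) * indicator (ball x (1 / 2)) w"
      by (auto split: split_indicator intro!: ennreal_leI)
  qed
  also have "\<dots> \<le> ennreal I"
    by (intro sub) (simp add: x_def e norm_divide)
  finally have "cmod (u x) * (pi / 16) \<le> I"
    using I(2) by (simp add: ennreal_mult[symmetric])
  then have far: "cmod (U (-1 / 2)) \<le> 16 / pi * I"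
    by (simp add: U_def x_def field_simps)
  have "cmod (u 0) \<le> cmod (U 0 - U (-1 / 2)) + cmod (U (-1 / 2))"
    using norm_triangle_ineq[of "U 0 - U (-1 / 2)" "U (-1 / 2)"] by (simp add: U_def)
  also have "\<dots> \<le> (256 * exp 1 / pi + 16 / pi) * I"
    using near far by (simp add: K_def field_simps)
  finally have "ennreal (cmod (u 0)) \<le> ennreal ((256 * exp 1 / pi + 16 / pi) * I)"
    by (rule ennreal_leI)
  then show ?thesis
    using I by (simp add: H_def ennreal_mult)
qed

section \<open>Pluriharmonic functions on slices\<close>

text \<open>The condition on \<open>D\<close> is the Cauchy-Riemann equation: it turns the
  real-linear map \<open>D\<close> into multiplication by \<open>D 1\<close>.\<close>

lemma has_field_derivative_if_complex_linear:
  assumes d: "(f has_derivative D) (at z)" and D: "D \<i> = \<i> * D 1"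
  shows "(f has_field_derivative D 1) (at z)"
proof -
  have l: "linear D" using d has_derivative_linear by blast
  have "D w = D 1 * w" for w
  proof -
    have "w = Re w *\<^sub>R 1 + Im w *\<^sub>R \<i>"
      by (simp add: complex_eq_iff)
    then have "D w = D (Re w *\<^sub>R 1 + Im w *\<^sub>R \<i>)"
      by (rule arg_cong)
    also have "\<dots> = Re w *\<^sub>R D 1 + Im w *\<^sub>R D \<i>"
      by (simp only: linear_add[OF l] linear_scale[OF l])
    also have "\<dots> = D 1 * w"
      by (subst complex_eq[of w]) (simp add: D scaleR_conv_of_real algebra_simps)
    finally show ?thesis .
  qed
  then have "D = (*) (D 1)" by (intro ext)
  then show ?thesis
    using d by (simp add: has_field_derivative_def)
qed

lemma bounded_linear_axis: "bounded_linear (axis j :: 'a::euclidean_space \<Rightarrow> 'a ^ 'n)"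
  by (intro linear_conv_bounded_linear[THEN iffD1] linearI) (auto simp: axis_def vec_eq_iff)

lemma has_derivative_slice:
  fixes f :: "complex ^ 'n \<Rightarrow> complex"
  assumes "f differentiable (at (z + axis j \<zeta>))"
  shows "((\<lambda>\<zeta>. f (z + axis j \<zeta>)) has_derivative (\<lambda>v. dir_deriv (axis j v) f (z + axis j \<zeta>))) (at \<zeta>)"
proof -
  have "((\<lambda>\<zeta>. z + axis j \<zeta>) has_derivative axis j) (at \<zeta>)"
    by (auto intro!: derivative_eq_intros bounded_linear_imp_has_derivative bounded_linear_axis)
  from has_derivative_compose[OF this frechet_derivative_works[THEN iffD1, OF assms]]
  show ?thesis
    by (simp add: dir_deriv_def)
qed

lemma has_derivative_cnj: "(f has_derivative D) F \<Longrightarrow> ((\<lambda>x. cnj (f x)) has_derivative (\<lambda>v. cnj (D v))) F"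
  by (rule bounded_linear.has_derivative[OF bounded_linear_cnj])

text \<open>On the slice, the conjugate Wirtinger derivative \<open>V\<close> of f is
  antiholomorphic. Let \<open>h\<close> be a primitive of its conjugate. Then \<open>cnj h\<close>
  also has conjugate Wirtinger derivative \<open>V\<close>, so subtracting it from f leaves an
  entire function.\<close>

lemma pluriharmonic_slice:
  fixes f :: "complex ^ 'n \<Rightarrow> complex"
  assumes "pluriharmonic f"
  obtains g h where "g holomorphic_on UNIV" "h holomorphic_on UNIV"
    "\<And>\<zeta>. f (z + axis j \<zeta>) = g \<zeta> + cnj (h \<zeta>)"
proof -
  have d: "f differentiable (at x)" "dir_deriv v f differentiable (at x)"
    and ph: "wirtinger j (wirtinger_bar j f) x = 0" for x v
    using assms by (auto simp: pluriharmonic_def twice_cont_differentiable_def)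
  have wd: "wirtinger_bar j f differentiable (at x)" for x
    unfolding wirtinger_bar_def[abs_def] using d
    by (intro differentiable_divide differentiable_add differentiable_mult differentiable_const) auto
  define V where "V = (\<lambda>\<zeta>. wirtinger_bar j f (z + axis j \<zeta>))"
  have "(\<lambda>\<zeta>. cnj (V \<zeta>)) field_differentiable (at \<zeta>)" for \<zeta>
  proof -
    \<comment> \<open>Conjugating this equation gives the Cauchy-Riemann equation for
      \<open>cnj (V \<zeta>)\<close>.\<close>
    have "wirtinger j (wirtinger_bar j f) (z + axis j \<zeta>) = 0"
      by (rule ph)
    then have "cnj (dir_deriv (axis j \<i>) (wirtinger_bar j f) (z + axis j \<zeta>))
        = \<i> * cnj (dir_deriv (axis j 1) (wirtinger_bar j f) (z + axis j \<zeta>))"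
      by (simp add: wirtinger_def complex_eq_iff)
    from has_field_derivative_if_complex_linear[OF has_derivative_cnj[OF has_derivative_slice[OF wd]] this]
    show ?thesis
      unfolding V_def field_differentiable_def by blast
  qed
  then have "(\<lambda>\<zeta>. cnj (V \<zeta>)) holomorphic_on UNIV"
    by (simp add: holomorphic_on_def field_differentiable_at_within)
  then obtain h where h: "\<And>\<zeta>. (h has_field_derivative cnj (V \<zeta>)) (at \<zeta>)"
    using holomorphic_convex_primitive'[of UNIV "\<lambda>\<zeta>. cnj (V \<zeta>)"] by auto
  define g where "g = (\<lambda>\<zeta>. f (z + axis j \<zeta>) - cnj (h \<zeta>))"
  have "g field_differentiable (at \<zeta>)" for \<zeta>
  proof -
    have "(g has_derivative (\<lambda>v. dir_deriv (axis j v) f (z + axis j \<zeta>) - cnj (cnj (V \<zeta>) * v))) (at \<zeta>)"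
      unfolding g_def using h[of \<zeta>]
      by (intro has_derivative_diff has_derivative_slice has_derivative_cnj d) (simp add: has_field_derivative_def)
    moreover have "dir_deriv (axis j \<i>) f (z + axis j \<zeta>) - cnj (cnj (V \<zeta>) * \<i>)
        = \<i> * (dir_deriv (axis j 1) f (z + axis j \<zeta>) - cnj (cnj (V \<zeta>) * 1))"
      by (simp add: V_def wirtinger_bar_def complex_eq_iff field_simps)
    ultimately show ?thesis
      unfolding field_differentiable_def by (blast intro: has_field_derivative_if_complex_linear)
  qed
  then have "g holomorphic_on UNIV"
    by (simp add: holomorphic_on_def field_differentiable_at_within)
  moreover have "h holomorphic_on UNIV"
    using h by (auto simp: holomorphic_on_open)
  moreover have "f (z + axis j \<zeta>) = g \<zeta> + cnj (h \<zeta>)" for \<zeta>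
    by (simp add: g_def)
  ultimately show ?thesis
    by (rule that)
qed

section \<open>The Gaussian weight on coordinate slices\<close>

lemma pluriharmonic_continuous: "pluriharmonic f \<Longrightarrow> continuous_on S f"
  by (auto simp: pluriharmonic_def twice_cont_differentiable_def
      intro!: continuous_at_imp_continuous_on differentiable_imp_continuous_within)

text \<open>The local estimate is proved first for exponent 1, in terms of this quantity, and raised
  to the power \<open>p\<close> only after all coordinates have been treated.\<close>

definition weighted_modulus :: "real \<Rightarrow> (complex ^ 'n \<Rightarrow> complex) \<Rightarrow> complex ^ 'n \<Rightarrow> real" where
  "weighted_modulus \<alpha> f z = cmod (f z) * exp (- (norm z)\<^sup>2 / (2 * \<alpha>))"

lemma weighted_power_eq: "weighted_power p \<alpha> f z = weighted_modulus \<alpha> f z powr p"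
  by (simp add: weighted_power_def weighted_modulus_def norm_mult)

lemma weighted_modulus_nonneg [simp]: "0 \<le> weighted_modulus \<alpha> f z"
  by (simp add: weighted_modulus_def)

lemma continuous_weighted_modulus:
  "continuous_on UNIV f \<Longrightarrow> \<alpha> \<noteq> 0 \<Longrightarrow> continuous_on S (weighted_modulus \<alpha> f)"
  unfolding weighted_modulus_def[abs_def]
  by (intro continuous_intros) (auto elim: continuous_on_subset)

lemma norm_add_axis_squared:
  fixes z :: "complex ^ 'n"
  shows "(norm (z + axis j \<zeta>))\<^sup>2 = (norm z)\<^sup>2 + 2 * Re (cnj (z $ j) * \<zeta>) + (cmod \<zeta>)\<^sup>2"
proof -
  have "(norm (z + axis j \<zeta>))\<^sup>2 = (norm z)\<^sup>2 + 2 * (z \<bullet> axis j \<zeta>) + (norm (axis j \<zeta>))\<^sup>2"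
    by (simp add: power2_norm_eq_inner inner_add_left inner_add_right inner_commute)
  then show ?thesis
    by (simp add: inner_axis power2_norm_eq_inner inner_axis_axis) (simp add: inner_complex_def)
qed

text \<open>Expanding the square of \<open>norm (z + axis j \<zeta>)\<close> shows that on the slice
  the weight is a constant times the modulus of exp (- a \<zeta>) times exp (- |\<zeta>|^2 / (2
  \<alpha>)). The last factor is absorbed by \<open>exp (1 / (2 * \<alpha>))\<close> on the unit
  disc. The one-variable estimate is uniform in \<open>a\<close>, hence this one is uniform in
  \<open>z\<close> and \<open>j\<close>.\<close>

lemma weighted_modulus_slice_bound:
  fixes f :: "complex ^ 'n \<Rightarrow> complex"
  assumes f: "pluriharmonic f" and \<alpha>: "\<alpha> > 0"
  shows "ennreal (weighted_modulus \<alpha> f z)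
    \<le> ennreal ((256 * exp 1 / pi + 16 / pi) * exp (1 / (2 * \<alpha>)))
        * (\<integral>\<^sup>+\<zeta>\<in>ball 0 1. weighted_modulus \<alpha> f (z + axis j \<zeta>) \<partial>lborel)"
proof -
  define C :: real where "C = 256 * exp 1 / pi + 16 / pi"
  have C: "C \<ge> 0" by (simp add: C_def)
  obtain g h where gh: "g holomorphic_on UNIV" "h holomorphic_on UNIV"
    and fgh: "\<And>\<zeta>. f (z + axis j \<zeta>) = g \<zeta> + cnj (h \<zeta>)"
    using pluriharmonic_slice[OF f] by metis
  have [measurable]: "(\<lambda>\<zeta>. f (z + axis j \<zeta>)) \<in> borel_measurable borel"
    unfolding fgh using gh
    by (intro borel_measurable_continuous_onI continuous_intros holomorphic_on_imp_continuous_on)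
  have [measurable]: "ball (0 :: complex) 1 \<in> sets borel" by simp
  define a where "a = cnj (z $ j) / of_real \<alpha>"
  define E where "E = exp (- (norm z)\<^sup>2 / (2 * \<alpha>))"
  have E: "E > 0" by (simp add: E_def)
  have weight: "E * cmod (exp (- a * \<zeta>)) \<le> exp (1 / (2 * \<alpha>)) * exp (- (norm (z + axis j \<zeta>))\<^sup>2 / (2 * \<alpha>))"
    if "\<zeta> \<in> ball 0 1" for \<zeta>
  proof -
    have "(cmod \<zeta>)\<^sup>2 \<le> 1" using that by (simp add: power_le_one)
    then have *: "(norm (z + axis j \<zeta>))\<^sup>2 \<le> (norm z)\<^sup>2 + 2 * Re (cnj (z $ j) * \<zeta>) + 1"
      by (simp add: norm_add_axis_squared)
    have "- a * \<zeta> = of_real (- 1 / \<alpha>) * (cnj (z $ j) * \<zeta>)"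
      by (simp add: a_def)
    then have "Re (- a * \<zeta>) = - 1 / \<alpha> * Re (cnj (z $ j) * \<zeta>)"
      by (simp only: Re_complex_of_real times_complex.simps Im_complex_of_real)
    then have "- (norm z)\<^sup>2 / (2 * \<alpha>) + Re (- a * \<zeta>) = (- (norm z)\<^sup>2 - 2 * Re (cnj (z $ j) * \<zeta>)) / (2 * \<alpha>)"
      using \<alpha> by (simp add: field_simps del: times_complex.simps)
    also have "\<dots> \<le> (1 - (norm (z + axis j \<zeta>))\<^sup>2) / (2 * \<alpha>)"
      using * \<alpha> by (intro divide_right_mono) auto
    finally have "- (norm z)\<^sup>2 / (2 * \<alpha>) + Re (- a * \<zeta>) \<le> 1 / (2 * \<alpha>) + - (norm (z + axis j \<zeta>))\<^sup>2 / (2 * \<alpha>)"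
      by (simp add: diff_divide_distrib)
    then show ?thesis
      by (simp add: E_def norm_exp_eq_Re del: times_complex.simps flip: exp_add)
  qed
  have "axis j 0 = (0 :: complex ^ 'n)"
    by (simp add: axis_eq_0_iff)
  then have "f z = g 0 + cnj (h 0)"
    using fgh[of 0] by (simp only: add_0_right)
  then have "weighted_modulus \<alpha> f z = E * cmod (g 0 + cnj (h 0))"
    by (simp only: weighted_modulus_def E_def mult.commute)
  then have "ennreal (weighted_modulus \<alpha> f z) = ennreal E * ennreal (cmod (g 0 + cnj (h 0)))"
    using E by (simp only: ennreal_mult norm_ge_zero less_imp_le)
  also have "\<dots> \<le> ennreal E * (ennreal C * (\<integral>\<^sup>+\<zeta>\<in>ball 0 1. cmod (f (z + axis j \<zeta>) * exp (- a * \<zeta>)) \<partial>lborel))"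
    using harmonic_weighted_mean_bound[OF gh, of a] by (intro mult_left_mono) (simp_all add: C_def fgh)
  also have "\<dots> = ennreal C * (\<integral>\<^sup>+\<zeta>\<in>ball 0 1. ennreal (E * cmod (f (z + axis j \<zeta>) * exp (- a * \<zeta>))) \<partial>lborel)"
  proof -
    have "(\<integral>\<^sup>+\<zeta>\<in>ball 0 1. ennreal (E * cmod (f (z + axis j \<zeta>) * exp (- a * \<zeta>))) \<partial>lborel)
        = ennreal E * (\<integral>\<^sup>+\<zeta>\<in>ball 0 1. cmod (f (z + axis j \<zeta>) * exp (- a * \<zeta>)) \<partial>lborel)"
      using E by (subst nn_integral_cmult[symmetric]) (simp_all only: ennreal_mult norm_ge_zero less_imp_le mult.assoc, measurable)
    then show ?thesis
      by (simp only: mult.left_commute)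
  qed
  also have "\<dots> \<le> ennreal C * (\<integral>\<^sup>+\<zeta>\<in>ball 0 1. ennreal (exp (1 / (2 * \<alpha>)) * weighted_modulus \<alpha> f (z + axis j \<zeta>)) \<partial>lborel)"
  proof (intro mult_left_mono nn_integral_mono)
    fix \<zeta>
    have "E * cmod (f (z + axis j \<zeta>) * exp (- a * \<zeta>)) \<le> exp (1 / (2 * \<alpha>)) * weighted_modulus \<alpha> f (z + axis j \<zeta>)"
      if "\<zeta> \<in> ball 0 1"
      using mult_left_mono[OF weight[OF that], of "cmod (f (z + axis j \<zeta>))"]
      by (simp add: weighted_modulus_def norm_mult mult_ac)
    then show "ennreal (E * cmod (f (z + axis j \<zeta>) * exp (- a * \<zeta>))) * indicator (ball 0 1) \<zeta>
        \<le> ennreal (exp (1 / (2 * \<alpha>)) * weighted_modulus \<alpha> f (z + axis j \<zeta>)) * indicator (ball 0 1) \<zeta>"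
      by (auto split: split_indicator intro!: ennreal_leI)
  qed simp
  also have "\<dots> = ennreal (C * exp (1 / (2 * \<alpha>))) * (\<integral>\<^sup>+\<zeta>\<in>ball 0 1. weighted_modulus \<alpha> f (z + axis j \<zeta>) \<partial>lborel)"
  proof -
    have [measurable]: "(\<lambda>\<zeta>. weighted_modulus \<alpha> f (z + axis j \<zeta>)) \<in> borel_measurable borel"
      unfolding weighted_modulus_def norm_add_axis_squared by measurable
    have "(\<integral>\<^sup>+\<zeta>\<in>ball 0 1. ennreal (exp (1 / (2 * \<alpha>)) * weighted_modulus \<alpha> f (z + axis j \<zeta>)) \<partial>lborel)
        = ennreal (exp (1 / (2 * \<alpha>))) * (\<integral>\<^sup>+\<zeta>\<in>ball 0 1. weighted_modulus \<alpha> f (z + axis j \<zeta>) \<partial>lborel)"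
      by (subst nn_integral_cmult[symmetric]) (simp_all only: ennreal_mult weighted_modulus_nonneg exp_ge_zero mult.assoc, measurable)
    then show ?thesis
      using C by (simp only: ennreal_mult exp_ge_zero mult.assoc)
  qed
  finally show ?thesis
    by (simp add: C_def)
qed

section \<open>The local estimate\<close>

text \<open>The basis vectors are the \<open>axis i b\<close>, so the volume of a box factors over
  the coordinates. This allows integration over one complex coordinate at a time.\<close>

lemma lborel_vec_eq:
  "(lborel :: ('a :: euclidean_space ^ 'n) measure)
    = distr (\<Pi>\<^sub>M i\<in>UNIV. lborel) borel (\<lambda>x. \<chi> i. x i)"
proof (rule lborel_eqI)
  interpret product_sigma_finite "\<lambda>_ :: 'n. lborel :: 'a measure"
    by standard
  have Basis: "(Basis :: ('a ^ 'n) set) = (\<lambda>(i, b). axis i b) ` (UNIV \<times> Basis)"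
    by (auto simp: Basis_vec_def)
  have inj: "inj_on (\<lambda>(i, b). axis i b :: 'a ^ 'n) (UNIV \<times> Basis)"
    by (auto simp: inj_on_def axis_eq_axis)
  fix l u :: "'a ^ 'n"
  assume lu: "\<And>b. b \<in> Basis \<Longrightarrow> l \<bullet> b \<le> u \<bullet> b"
  have le: "l $ i \<bullet> b \<le> u $ i \<bullet> b" if "b \<in> Basis" for i b
    using lu[of "axis i b"] that by (auto simp: Basis inner_axis)
  have m: "(\<lambda>x. \<chi> i. x i) \<in> borel_measurable (\<Pi>\<^sub>M i\<in>(UNIV :: 'n set). lborel :: 'a measure)"
    by (subst borel_measurable_euclidean_space) (auto simp: Basis inner_axis)
  have "(\<lambda>x. \<chi> i. x i) -` box l u \<inter> space (\<Pi>\<^sub>M i\<in>(UNIV :: 'n set). lborel :: 'a measure)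
      = (\<Pi>\<^sub>E i\<in>UNIV. box (l $ i) (u $ i))"
    by (auto simp: space_PiM box_def Basis inner_axis PiE_def extensional_def)
  then have "emeasure (distr (\<Pi>\<^sub>M i\<in>UNIV. lborel) borel (\<lambda>x. \<chi> i. x i)) (box l u)
      = emeasure (\<Pi>\<^sub>M i\<in>UNIV. lborel) (\<Pi>\<^sub>E i\<in>(UNIV :: 'n set). box (l $ i) (u $ i))"
    by (subst emeasure_distr[OF m]) auto
  also have "\<dots> = (\<Prod>i\<in>UNIV. emeasure lborel (box (l $ i) (u $ i)))"
    by (rule emeasure_PiM) auto
  also have "\<dots> = (\<Prod>i\<in>UNIV. ennreal (\<Prod>b\<in>Basis. (u $ i - l $ i) \<bullet> b))"
    by (intro prod.cong emeasure_lborel_box refl le)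
  also have "\<dots> = ennreal (\<Prod>i\<in>UNIV. \<Prod>b\<in>Basis. (u $ i - l $ i) \<bullet> b)"
    by (intro prod_ennreal prod_nonneg) (auto simp: inner_diff_left le)
  also have "(\<Prod>i\<in>UNIV. \<Prod>b\<in>Basis. (u $ i - l $ i) \<bullet> b) = (\<Prod>b\<in>Basis. (u - l) \<bullet> b)"
    unfolding Basis by (subst prod.reindex[OF inj]) (simp add: prod.cartesian_product inner_axis split_beta')
  finally show "emeasure (distr (\<Pi>\<^sub>M i\<in>UNIV. lborel) borel (\<lambda>x. \<chi> i. x i)) (box l u)
      = ennreal (\<Prod>b\<in>Basis. (u - l) \<bullet> b)" .
qed simp

lemma measurable_vec_lambda_PiM [measurable]:
  "(\<lambda>x. \<chi> i. x i) \<in> borel_measurable (\<Pi>\<^sub>M i\<in>(UNIV :: 'n::finite set). lborel :: 'a :: euclidean_space measure)"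
  by (subst borel_measurable_euclidean_space) (auto simp: Basis_vec_def inner_axis)

lemma measurable_axis [measurable]: "(axis j :: 'a::euclidean_space \<Rightarrow> 'a ^ 'n) \<in> borel_measurable borel"
  by (intro borel_measurable_continuous_onI linear_continuous_on bounded_linear_axis)

text \<open>Apply the slice bound in one coordinate after another; \<open>J\<close> holds the
  coordinates already treated and each costs one factor \<open>C\<close>.\<close>

lemma iterated_slice_bound:
  fixes G :: "complex ^ 'n \<Rightarrow> ennreal"
  assumes [measurable]: "G \<in> borel_measurable borel" "D \<in> sets borel"
    and slice: "\<And>z j. G z \<le> C * (\<integral>\<^sup>+\<zeta>\<in>D. G (z + axis j \<zeta>) \<partial>lborel)"
    and J: "finite J"
  shows "G z \<le> C ^ card J * (\<integral>\<^sup>+x. G (z + (\<Sum>j\<in>J. axis j (x j))) * (\<Prod>j\<in>J. indicator D (x j)) \<partial>(\<Pi>\<^sub>M j\<in>J. lborel))"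
  using J
proof (induction J arbitrary: z)
  case empty
  show ?case
    by (simp add: PiM_empty)
next
  case (insert j J)
  interpret product_sigma_finite "\<lambda>_ :: 'n. lborel :: complex measure"
    by standard
  have "G z \<le> C * (\<integral>\<^sup>+\<zeta>\<in>D. G (z + axis j \<zeta>) \<partial>lborel)"
    by (rule slice)
  \<comment> \<open>The induction hypothesis is needed at the shifted centre
    \<open>z + axis j \<zeta>\<close>, whence the induction with \<open>z\<close> arbitrary.\<close>
  also have "\<dots> \<le> C * (\<integral>\<^sup>+\<zeta>\<in>D. C ^ card J * (\<integral>\<^sup>+x. G (z + axis j \<zeta> + (\<Sum>j\<in>J. axis j (x j))) * (\<Prod>j\<in>J. indicator D (x j)) \<partial>(\<Pi>\<^sub>M j\<in>J. lborel)) \<partial>lborel)"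
    by (intro mult_left_mono nn_integral_mono mult_right_mono insert.IH) auto
  also have "\<dots> = C * (C ^ card J * (\<integral>\<^sup>+\<zeta>. \<integral>\<^sup>+x. G (z + axis j \<zeta> + (\<Sum>j\<in>J. axis j (x j))) * (\<Prod>j\<in>J. indicator D (x j)) * indicator D \<zeta> \<partial>(\<Pi>\<^sub>M j\<in>J. lborel) \<partial>lborel))"
  proof -
    interpret J: finite_product_sigma_finite "\<lambda>_ :: 'n. lborel :: complex measure" J
      by standard (rule insert.hyps)
    define \<Phi> where "\<Phi> = (\<lambda>\<zeta> (x :: 'n \<Rightarrow> complex). G (z + axis j \<zeta> + (\<Sum>j\<in>J. axis j (x j))) * (\<Prod>j\<in>J. indicator D (x j)))"
    have \<Phi> [measurable]: "(\<lambda>(\<zeta>, x). \<Phi> \<zeta> x) \<in> borel_measurable (lborel \<Otimes>\<^sub>M (\<Pi>\<^sub>M j\<in>J. lborel))"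
      unfolding \<Phi>_def by measurable
    have [measurable]: "\<Phi> \<zeta> \<in> borel_measurable (\<Pi>\<^sub>M j\<in>J. lborel)" for \<zeta>
      using measurable_Pair2[OF \<Phi>, of \<zeta>] by simp
    have [measurable]: "(\<lambda>\<zeta>. \<integral>\<^sup>+x. \<Phi> \<zeta> x \<partial>(\<Pi>\<^sub>M j\<in>J. lborel)) \<in> borel_measurable borel"
      using J.borel_measurable_nn_integral[OF \<Phi>] by simp
    have "(\<integral>\<^sup>+\<zeta>\<in>D. C ^ card J * (\<integral>\<^sup>+x. \<Phi> \<zeta> x \<partial>(\<Pi>\<^sub>M j\<in>J. lborel)) \<partial>lborel)
        = C ^ card J * (\<integral>\<^sup>+\<zeta>. (\<integral>\<^sup>+x. \<Phi> \<zeta> x \<partial>(\<Pi>\<^sub>M j\<in>J. lborel)) * indicator D \<zeta> \<partial>lborel)"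
      by (simp add: mult.assoc nn_integral_cmult)
    also have "\<dots> = C ^ card J * (\<integral>\<^sup>+\<zeta>. \<integral>\<^sup>+x. \<Phi> \<zeta> x * indicator D \<zeta> \<partial>(\<Pi>\<^sub>M j\<in>J. lborel) \<partial>lborel)"
      by (simp add: nn_integral_multc)
    finally show ?thesis
      by (simp only: \<Phi>_def)
  qed
  also have "\<dots> = C ^ card (insert j J) * (\<integral>\<^sup>+\<zeta>. \<integral>\<^sup>+x. G (z + (\<Sum>k\<in>insert j J. axis k ((x(j := \<zeta>)) k))) * (\<Prod>k\<in>insert j J. indicator D ((x(j := \<zeta>)) k)) \<partial>(\<Pi>\<^sub>M j\<in>J. lborel) \<partial>lborel)"
  proof -
    have "(\<Sum>k\<in>J. axis k ((x(j := \<zeta>)) k)) = (\<Sum>k\<in>J. axis k (x k))"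
      and "(\<Prod>k\<in>J. indicator D ((x(j := \<zeta>)) k) :: ennreal) = (\<Prod>k\<in>J. indicator D (x k))"
      for x :: "'n \<Rightarrow> complex" and \<zeta>
      using insert.hyps by (auto intro!: sum.cong prod.cong)
    then show ?thesis
      by (simp only: sum.insert[OF insert.hyps] prod.insert[OF insert.hyps] card_insert_disjoint[OF insert.hyps] power_Suc mult.assoc add.assoc fun_upd_same) (simp only: mult_ac)
  qed
  also have "\<dots> = C ^ card (insert j J) * (\<integral>\<^sup>+x. G (z + (\<Sum>k\<in>insert j J. axis k (x k))) * (\<Prod>k\<in>insert j J. indicator D (x k)) \<partial>(\<Pi>\<^sub>M j\<in>insert j J. lborel))"
    using insert.hyps by (subst product_nn_integral_insert_rev) auto
  finally show ?case .
qed

text \<open>With all coordinates treated, the integral runs over the unit polydisc around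
  \<open>z\<close>. It is enlarged to a ball, the shape in which \<mu> is controlled.\<close>

lemma polydisc_bound:
  fixes G :: "complex ^ 'n \<Rightarrow> ennreal"
  assumes [measurable]: "G \<in> borel_measurable borel"
    and slice: "\<And>z j. G z \<le> C * (\<integral>\<^sup>+\<zeta>\<in>ball 0 1. G (z + axis j \<zeta>) \<partial>lborel)"
  shows "G z \<le> C ^ CARD('n) * (\<integral>\<^sup>+w\<in>ball z (CARD('n) + 1). G w \<partial>lborel)"
proof -
  define S where "S = {w :: complex ^ 'n. \<forall>j. w $ j \<in> ball 0 1}"
  \<comment> \<open>The norm is at most the sum of the coordinate moduli, which is bounded by the
    dimension; the extra 1 gives the strict inequality for an open ball.\<close>
  have S: "S \<subseteq> ball 0 (CARD('n) + 1)"
  proof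
    fix w :: "complex ^ 'n" assume "w \<in> S"
    have "norm w \<le> (\<Sum>j\<in>UNIV. cmod (w $ j))"
      unfolding norm_vec_def by (rule L2_set_le_sum) simp
    also have "\<dots> \<le> (\<Sum>j\<in>(UNIV :: 'n set). 1)"
      using \<open>w \<in> S\<close> by (intro sum_mono) (auto simp: S_def less_imp_le)
    finally show "w \<in> ball 0 (CARD('n) + 1)" by simp
  qed
  have [measurable]: "ball y r \<in> sets borel" for y :: "complex ^ 'n" and r by simp
  have "G z \<le> C ^ CARD('n) * (\<integral>\<^sup>+x. G (z + (\<Sum>j\<in>UNIV. axis j (x j))) * (\<Prod>j\<in>UNIV. indicator (ball 0 1) (x j)) \<partial>(\<Pi>\<^sub>M j\<in>UNIV. lborel))"
    by (rule iterated_slice_bound) (auto intro: slice)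
  also have "\<dots> \<le> C ^ CARD('n) * (\<integral>\<^sup>+x. G (z + (\<chi> j. x j)) * indicator (ball 0 (CARD('n) + 1)) (\<chi> j. x j) \<partial>(\<Pi>\<^sub>M j\<in>UNIV. lborel))"
  proof (intro mult_left_mono nn_integral_mono)
    fix x :: "'n \<Rightarrow> complex"
    have 1: "(\<Sum>j\<in>UNIV. axis j (x j)) = (\<chi> j. x j)"
      by (simp add: vec_eq_iff axis_def)
    have 2: "(\<Prod>j\<in>UNIV. indicator (ball 0 1) (x j) :: ennreal) \<le> indicator (ball 0 (CARD('n) + 1)) (\<chi> j. x j)"
    proof (cases "(\<chi> j. x j) \<in> S")
      case True
      then have "(\<chi> j. x j) \<in> ball 0 (CARD('n) + 1)" using S by blast
      then show ?thesis using True by (simp add: S_def)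
    next
      case False
      then obtain j where "x j \<notin> ball 0 1" by (auto simp: S_def)
      then have "(\<Prod>j\<in>UNIV. indicator (ball 0 1) (x j) :: ennreal) = 0"
        by (intro prod_zero) (auto intro!: exI[of _ j])
      then show ?thesis by (simp only: zero_le)
    qed
    show "G (z + (\<Sum>j\<in>UNIV. axis j (x j))) * (\<Prod>j\<in>UNIV. indicator (ball 0 1) (x j))
        \<le> G (z + (\<chi> j. x j)) * indicator (ball 0 (CARD('n) + 1)) (\<chi> j. x j)"
      unfolding 1 by (rule mult_left_mono[OF 2]) simp
  qed simp
  also have "\<dots> = C ^ CARD('n) * (\<integral>\<^sup>+w. G (z + w) * indicator (ball 0 (CARD('n) + 1)) w \<partial>lborel)"
    by (subst lborel_vec_eq, subst nn_integral_distr) auto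
  also have "(\<integral>\<^sup>+w. G (z + w) * indicator (ball 0 (CARD('n) + 1)) w \<partial>lborel)
      = (\<integral>\<^sup>+w. G (z + w) * indicator (ball z (CARD('n) + 1)) (z + w) \<partial>lborel)"
    by (intro nn_integral_cong) (simp add: indicator_def dist_norm)
  also have "\<dots> = (\<integral>\<^sup>+w\<in>ball z (CARD('n) + 1). G w \<partial>lborel)"
    by (rule nn_integral_translate[where f = "\<lambda>w. G w * indicator (ball z (CARD('n) + 1)) w"]) measurable
  finally show ?thesis .
qed

text \<open>A quantitative form of Jensen's inequality, with a worse constant: integrate
  \<open>x \<le> t powr (1 - p) * x powr p + t\<close> and choose \<open>t\<close> so that the second term is absorbed.\<close>

lemma powr_bound_of_nn_integral_bound:
  fixes f :: "'a \<Rightarrow> real"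
  assumes [measurable]: "f \<in> borel_measurable M" "S \<in> sets M"
    and f: "\<And>w. 0 \<le> f w" and a: "0 \<le> a" and C: "C > 0" and m: "m > 0" and p: "p \<ge> 1"
    and S: "emeasure M S \<le> ennreal m"
    and bound: "ennreal a \<le> ennreal C * (\<integral>\<^sup>+w\<in>S. f w \<partial>M)"
  shows "ennreal (a powr p) \<le> ennreal (2 * C * (2 * C * m) powr (p - 1)) * (\<integral>\<^sup>+w\<in>S. f w powr p \<partial>M)"
proof (cases "a = 0 \<or> (\<integral>\<^sup>+w\<in>S. f w powr p \<partial>M) = \<infinity>")
  case True
  then show ?thesis
    using C m by (auto simp: ennreal_mult_top)
next
  case False
  then have a: "a > 0" using a by simp
  define I where "I = enn2real (\<integral>\<^sup>+w\<in>S. f w powr p \<partial>M)"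
  have I: "(\<integral>\<^sup>+w\<in>S. f w powr p \<partial>M) = ennreal I" "I \<ge> 0"
    using False by (auto simp: I_def ennreal_enn2real_if)
  \<comment> \<open>With this choice C t m = a / 2, which moves to the left-hand side and leaves a
    factor 2.\<close>
  define t where "t = a / (2 * C * m)"
  have t: "t > 0" using a C m by (simp add: t_def)
  \<comment> \<open>Where f exceeds \<open>t\<close>, write f as f^(1 - p) f^p and use that the
    exponent 1 - p is not positive; elsewhere the second term suffices.\<close>
  have pointwise: "f w \<le> t powr (1 - p) * f w powr p + t" for w
  proof (cases "f w \<le> t")
    case True
    then show ?thesis by (simp add: add_increasing)
  next
    case False
    then have "f w = f w powr (1 - p) * f w powr p"
      using t by (simp flip: powr_add)
    also have "\<dots> \<le> t powr (1 - p) * f w powr p"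
      using False t p by (intro mult_right_mono powr_mono2') auto
    finally show ?thesis using t by linarith
  qed
  have "(\<integral>\<^sup>+w\<in>S. f w \<partial>M) \<le> (\<integral>\<^sup>+w. ennreal (t powr (1 - p)) * (ennreal (f w powr p) * indicator S w) + ennreal t * indicator S w \<partial>M)"
  proof (intro nn_integral_mono)
    fix w
    have "ennreal (f w) \<le> ennreal (t powr (1 - p)) * ennreal (f w powr p) + ennreal t"
      using ennreal_leI[OF pointwise[of w]] t by (simp add: ennreal_mult)
    then show "ennreal (f w) * indicator S w \<le> ennreal (t powr (1 - p)) * (ennreal (f w powr p) * indicator S w) + ennreal t * indicator S w"
      by (auto split: split_indicator)
  qed
  also have "\<dots> = ennreal (t powr (1 - p)) * ennreal I + ennreal t * emeasure M S"
    unfolding I(1)[symmetric]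
    by (subst nn_integral_add) (auto simp: nn_integral_cmult nn_integral_cmult_indicator)
  also have "\<dots> \<le> ennreal (t powr (1 - p)) * ennreal I + ennreal t * ennreal m"
    by (intro add_left_mono mult_left_mono S) simp
  also have "\<dots> = ennreal (t powr (1 - p) * I + t * m)"
    using I(2) t m by (simp add: ennreal_mult)
  finally have "ennreal a \<le> ennreal C * ennreal (t powr (1 - p) * I + t * m)"
    by (intro order_trans[OF bound] mult_left_mono) auto
  also have "\<dots> = ennreal (C * (t powr (1 - p) * I + t * m))"
    using C I(2) t m by (intro ennreal_mult[symmetric]) auto
  finally have "a \<le> C * (t powr (1 - p) * I + t * m)"
    using C I(2) t m by (subst (asm) ennreal_le_iff) auto
  then have "a \<le> 2 * C * t powr (1 - p) * I"
    using C m by (simp add: t_def field_simps)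
  then have "a * t powr (p - 1) \<le> 2 * C * t powr (1 - p) * I * t powr (p - 1)"
    by (intro mult_right_mono) auto
  also have "\<dots> = 2 * C * I * (t powr (1 - p) * t powr (p - 1))"
    by simp
  also have "t powr (1 - p) * t powr (p - 1) = 1"
    using t by (simp flip: powr_add)
  finally have le: "a * t powr (p - 1) \<le> 2 * C * I" by simp
  have "a powr p = a * t powr (p - 1) * (2 * C * m) powr (p - 1)"
  proof -
    have "a powr p = a powr 1 * a powr (p - 1)"
      unfolding powr_add[symmetric] by simp
    moreover have "a powr (p - 1) = (t * (2 * C * m)) powr (p - 1)"
      using C m by (simp add: t_def)
    ultimately show ?thesis
      using a t C m by (simp add: powr_mult)
  qed
  also have "\<dots> \<le> 2 * C * I * (2 * C * m) powr (p - 1)"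
    by (intro mult_right_mono le) simp
  finally have "ennreal (a powr p) \<le> ennreal (2 * C * (2 * C * m) powr (p - 1) * I)"
    by (intro ennreal_leI) (simp add: mult_ac)
  then show ?thesis
    using C I by (simp add: ennreal_mult)
qed

text \<open>Iterating the slice estimate gives exponent 1 with constant \<open>B ^ CARD('n)\<close>,
  and \<open>powr_bound_of_nn_integral_bound\<close> passes to exponent \<open>p\<close>. Both
  constants are chosen before \<open>f\<close> and \<open>z\<close>; this uniformity is what the
  averaging against \<mu> relies on.\<close>

lemma weighted_power_bound:
  assumes p: "p \<ge> 1" and \<alpha>: "\<alpha> > 0"
  obtains C \<rho> :: real where "C > 0" "\<rho> > 0"
    "\<And>f (z :: complex ^ 'n). pluriharmonic f \<Longrightarrow>
      ennreal (weighted_power p \<alpha> f z) \<le> ennreal C * (\<integral>\<^sup>+w\<in>ball z \<rho>. weighted_power p \<alpha> f w \<partial>lborel)"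
proof -
  define B where "B = (256 * exp 1 / pi + 16 / pi) * exp (1 / (2 * \<alpha>))"
  have B: "B > 0" by (simp add: B_def add_pos_pos)
  define \<rho> where "\<rho> = real CARD('n) + 1"
  have \<rho>: "\<rho> > 0" by (simp add: \<rho>_def)
  define m where "m = measure lborel (ball (0 :: complex ^ 'n) \<rho>)"
  have em: "emeasure lborel (ball z \<rho>) = ennreal m" for z :: "complex ^ 'n"
    using \<rho> by (simp add: m_def emeasure_ball content_ball)
  have m: "m > 0"
    unfolding m_def using \<rho> by (intro content_ball_pos)
  define C where "C = 2 * B ^ CARD('n) * (2 * B ^ CARD('n) * m) powr (p - 1)"
  show ?thesis
  proof (rule that[of C \<rho>])
    show "C > 0" using B m by (simp add: C_def)
    show "\<rho> > 0" by (rule \<rho>)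
    fix f :: "complex ^ 'n \<Rightarrow> complex" and z
    assume f: "pluriharmonic f"
    have [measurable]: "weighted_modulus \<alpha> f \<in> borel_measurable borel"
      using \<alpha> by (intro borel_measurable_continuous_onI continuous_weighted_modulus pluriharmonic_continuous f) simp
    have "ennreal (weighted_modulus \<alpha> f z) \<le> ennreal B ^ CARD('n) * (\<integral>\<^sup>+w\<in>ball z (CARD('n) + 1). weighted_modulus \<alpha> f w \<partial>lborel)"
      by (rule polydisc_bound) (use weighted_modulus_slice_bound[OF f \<alpha>] in \<open>auto simp: B_def\<close>)
    then have "ennreal (weighted_modulus \<alpha> f z) \<le> ennreal (B ^ CARD('n)) * (\<integral>\<^sup>+w\<in>ball z \<rho>. weighted_modulus \<alpha> f w \<partial>lborel)"
      using B by (simp add: \<rho>_def ennreal_power add.commute)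
    then show "ennreal (weighted_power p \<alpha> f z) \<le> ennreal C * (\<integral>\<^sup>+w\<in>ball z \<rho>. weighted_power p \<alpha> f w \<partial>lborel)"
      unfolding weighted_power_eq C_def using B m p em
      by (intro powr_bound_of_nn_integral_bound) auto
  qed
qed

section \<open>Vanishing Carleson measures\<close>

lemma tendsto_0_ennrealI:
  fixes f :: "'a \<Rightarrow> ennreal"
  assumes "\<And>e. e > 0 \<Longrightarrow> eventually (\<lambda>x. f x \<le> ennreal e) F"
  shows "(f \<longlongrightarrow> 0) F"
proof (rule order_tendstoI)
  fix a :: ennreal assume "0 < a"
  then obtain b where b: "0 < b" "b < a" using dense by blast
  then obtain e where "b = ennreal e" "e \<ge> 0" by (cases b) auto
  then have "eventually (\<lambda>x. f x \<le> b) F"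
    using assms[of e] b by auto
  then show "eventually (\<lambda>x. f x < a) F"
    by eventually_elim (use b in auto)
qed simp

text \<open>By compactness a ball of radius \<rho> is covered by finitely many balls of radius
  \<open>r\<close>, and the same finite set \<open>Y\<close> of shifts works for every centre. This
  reconciles the prescribed radius with the one in the local estimate.\<close>

lemma emeasure_ball_tendsto_0_radius:
  fixes \<mu> :: "'a::euclidean_space measure"
  assumes \<mu>: "sets \<mu> = sets borel" and r: "r > 0"
    and lim: "((\<lambda>z. emeasure \<mu> (ball z r)) \<longlongrightarrow> 0) at_infinity"
  shows "((\<lambda>z. emeasure \<mu> (ball z \<rho>)) \<longlongrightarrow> 0) at_infinity"
proof -
  have "cball (0 :: 'a) \<rho> \<subseteq> (\<Union>y\<in>cball 0 \<rho>. ball y r)"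
    using r by force
  then obtain Y where Y: "finite Y" "cball (0 :: 'a) \<rho> \<subseteq> (\<Union>y\<in>Y. ball y r)"
    by (rule compactE_image[OF compact_cball, rotated]) auto
  have le: "emeasure \<mu> (ball z \<rho>) \<le> (\<Sum>y\<in>Y. emeasure \<mu> (ball (z + y) r))" for z
  proof -
    have "ball z \<rho> \<subseteq> (\<Union>y\<in>Y. ball (z + y) r)"
    proof
      fix w assume "w \<in> ball z \<rho>"
      then have "w - z \<in> cball 0 \<rho>"
        by (simp add: dist_norm norm_minus_commute)
      then obtain y where "y \<in> Y" "w - z \<in> ball y r"
        using Y(2) by blast
      then show "w \<in> (\<Union>y\<in>Y. ball (z + y) r)"
        by (auto simp: dist_norm algebra_simps)
    qed
    then have "emeasure \<mu> (ball z \<rho>) \<le> emeasure \<mu> (\<Union>y\<in>Y. ball (z + y) r)"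
      using Y(1) \<mu> by (intro emeasure_mono) auto
    also have "\<dots> \<le> (\<Sum>y\<in>Y. emeasure \<mu> (ball (z + y) r))"
      by (rule emeasure_subadditive_finite[OF Y(1)]) (simp add: \<mu> image_subset_iff)
    finally show ?thesis .
  qed
  have "((\<lambda>z. \<Sum>y\<in>Y. emeasure \<mu> (ball (z + y) r)) \<longlongrightarrow> (\<Sum>y\<in>Y. 0)) at_infinity"
  proof (intro tendsto_sum)
    fix y :: 'a
    have "filterlim (\<lambda>z. z + y) at_infinity at_infinity"
      by (rule tendsto_add_filterlim_at_infinity'[OF filterlim_ident tendsto_const])
    then show "((\<lambda>z. emeasure \<mu> (ball (z + y) r)) \<longlongrightarrow> 0) at_infinity"
      by (rule filterlim_compose[OF lim])
  qed
  then have lim': "((\<lambda>z. \<Sum>y\<in>Y. emeasure \<mu> (ball (z + y) r)) \<longlongrightarrow> 0) at_infinity"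
    by simp
  show ?thesis
    by (rule tendsto_sandwich[OF _ _ tendsto_const lim'])
       (intro always_eventually allI zero_le le)+
qed

section \<open>Averaging over balls with Tonelli's theorem\<close>

lemma sigma_finite_if_finite_on_compact:
  fixes \<mu> :: "'a::euclidean_space measure"
  assumes \<mu>: "sets \<mu> = sets borel" and fin: "\<And>K. compact K \<Longrightarrow> emeasure \<mu> K < \<infinity>"
  shows "sigma_finite_measure \<mu>"
proof
  have "(\<Union>n. cball (0 :: 'a) (real n)) = UNIV"
    using real_arch_simple by auto
  then show "\<exists>A. countable A \<and> A \<subseteq> sets \<mu> \<and> \<Union> A = space \<mu> \<and> (\<forall>a\<in>A. emeasure \<mu> a \<noteq> \<infinity>)"
    using fin[OF compact_cball] sets_eq_imp_space_eq[OF \<mu>] \<mu>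
    by (intro exI[of _ "range (\<lambda>n. cball 0 (real n))"]) (auto simp: less_top)
qed

text \<open>Insert the local bound and exchange the integrals: z ranges over the ball around w
  exactly when w ranges over the ball around z, so the inner integral becomes the \<mu>-measure of a
  ball.\<close>

lemma nn_integral_le_averaged_measure:
  fixes \<mu> :: "'a::euclidean_space measure" and g :: "'a \<Rightarrow> ennreal"
  assumes \<mu>: "sets \<mu> = sets borel" "sigma_finite_measure \<mu>"
    and [measurable]: "g \<in> borel_measurable borel"
    and g: "\<And>z. g z \<le> C * (\<integral>\<^sup>+w\<in>ball z \<rho>. g w \<partial>lborel)"
  shows "(\<integral>\<^sup>+z. g z \<partial>\<mu>) \<le> C * (\<integral>\<^sup>+w. g w * emeasure \<mu> (ball w \<rho>) \<partial>lborel)"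
proof -
  interpret \<mu>: sigma_finite_measure \<mu> by (rule \<mu>)
  interpret pair_sigma_finite \<mu> "lborel :: 'a measure" ..
  have [measurable_cong]: "sets \<mu> = sets borel" by (rule \<mu>)
  have "{p :: 'a \<times> 'a. dist (fst p) (snd p) < \<rho>} \<in> sets borel"
    by (intro borel_open open_Collect_less continuous_intros)
  then have [measurable]: "Measurable.pred (borel \<Otimes>\<^sub>M borel) (\<lambda>p :: 'a \<times> 'a. dist (fst p) (snd p) < \<rho>)"
    by (simp add: borel_prod pred_def)
  \<comment> \<open>The indicator of both families of balls as one jointly measurable kernel;
    \<open>kb\<close> reads it in either variable.\<close>
  define k where "k = (\<lambda>z w :: 'a. if dist z w < \<rho> then 1 else 0 :: ennreal)"
  have k [measurable]: "(\<lambda>(z, w). k z w) \<in> borel_measurable (borel \<Otimes>\<^sub>M borel)"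
    unfolding k_def split_beta' by measurable
  have km: "(\<lambda>(z, w). g w * k z w) \<in> borel_measurable (\<mu> \<Otimes>\<^sub>M lborel)"
    by measurable
  have [measurable]: "(\<lambda>z. \<integral>\<^sup>+w. g w * k z w \<partial>lborel) \<in> borel_measurable \<mu>"
    using lborel.borel_measurable_nn_integral[OF km] by simp
  have kb: "k z w = indicator (ball w \<rho>) z" "k z w = indicator (ball z \<rho>) w" for z w
    by (auto simp: k_def indicator_def dist_commute)
  have "(\<integral>\<^sup>+z. g z \<partial>\<mu>) \<le> (\<integral>\<^sup>+z. C * (\<integral>\<^sup>+w. g w * k z w \<partial>lborel) \<partial>\<mu>)"
    using g by (intro nn_integral_mono) (simp add: kb(2))
  also have "\<dots> = C * (\<integral>\<^sup>+z. \<integral>\<^sup>+w. g w * k z w \<partial>lborel \<partial>\<mu>)"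
    by (rule nn_integral_cmult) measurable
  also have "(\<integral>\<^sup>+z. \<integral>\<^sup>+w. g w * k z w \<partial>lborel \<partial>\<mu>) = (\<integral>\<^sup>+w. \<integral>\<^sup>+z. g w * k z w \<partial>\<mu> \<partial>lborel)"
    by (rule Fubini'[symmetric]) measurable
  also have "\<dots> = (\<integral>\<^sup>+w. g w * emeasure \<mu> (ball w \<rho>) \<partial>lborel)"
    unfolding kb(1) using \<mu> by (intro nn_integral_cong nn_integral_cmult_indicator) auto
  finally show ?thesis .
qed

section \<open>Gaussian integrals and coherent states\<close>

lemma nn_integral_exp_neg_norm_squared_finite:
  assumes c: "c > 0"
  shows "(\<integral>\<^sup>+w. ennreal (exp (- c * (norm w)\<^sup>2)) \<partial>(lborel :: 'a::euclidean_space measure)) < \<infinity>"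
proof -
  \<comment> \<open>The standard deviation for which the normal density is a multiple of exp (- c
    x^2).\<close>
  define \<sigma> where "\<sigma> = 1 / sqrt (2 * c)"
  have \<sigma>: "\<sigma> > 0" "2 * \<sigma>\<^sup>2 = 1 / c"
    using c by (auto simp: \<sigma>_def power_divide)
  have "integrable lborel (\<lambda>x. sqrt (2 * pi * \<sigma>\<^sup>2) * normal_density 0 \<sigma> x)"
    by (intro integrable_mult_right) (use \<sigma> in auto)
  moreover have "sqrt (2 * pi * \<sigma>\<^sup>2) * normal_density 0 \<sigma> x = exp (- c * x\<^sup>2)" for x
    using \<sigma> c by (simp add: normal_density_def)
  ultimately have "(\<integral>\<^sup>+x. ennreal (exp (- c * x\<^sup>2)) \<partial>lborel) < \<infinity>"
    by (simp add: integrable_iff_bounded)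
  \<comment> \<open>The squared norm is a sum over the basis, so the Gaussian is a product of
    one-dimensional ones.\<close>
  moreover have "(\<integral>\<^sup>+w. ennreal (exp (- c * (norm w)\<^sup>2)) \<partial>(lborel :: 'a measure))
      = (\<integral>\<^sup>+w. (\<Prod>b\<in>Basis. ennreal (exp (- c * (w \<bullet> b)\<^sup>2))) \<partial>(lborel :: 'a measure))"
  proof (rule nn_integral_cong)
    fix w :: 'a
    have "exp (- c * (norm w)\<^sup>2) = (\<Prod>b\<in>Basis. exp (- c * (w \<bullet> b)\<^sup>2))"
      by (simp add: exp_sum[symmetric] sum_distrib_left[symmetric] sum_negf norm_eq_sqrt_inner euclidean_inner[of w w] power2_eq_square sum_nonneg)
    then show "ennreal (exp (- c * (norm w)\<^sup>2)) = (\<Prod>b\<in>Basis. ennreal (exp (- c * (w \<bullet> b)\<^sup>2)))"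
      by (simp add: prod_ennreal)
  qed
  moreover have "\<dots> = (\<Prod>b\<in>(Basis :: 'a set). \<integral>\<^sup>+x. ennreal (exp (- c * x\<^sup>2)) \<partial>lborel)"
    by (rule nn_integral_lborel_prod) auto
  ultimately show ?thesis
    by (simp add: power_less_top_ennreal)
qed

text \<open>The normalized reproducing kernel at \<open>a\<close> of the Fock space with weight exp
  (- |w|^2 / \<alpha>).\<close>

definition coherent_state :: "real \<Rightarrow> complex ^ 'n \<Rightarrow> complex ^ 'n \<Rightarrow> complex" where
  "coherent_state \<alpha> a w = exp ((\<Sum>j\<in>UNIV. cnj (a $ j) * w $ j) / of_real \<alpha> - of_real ((norm a)\<^sup>2 / (2 * \<alpha>)))"

text \<open>A directional derivative is again a constant multiple of the same function. Carrying the
  factor \<open>c\<close> lets the formula be applied to its own result, as the \<open>C^2\<close>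
  condition requires.\<close>

lemma dir_deriv_coherent_state:
  fixes a :: "complex ^ 'n"
  shows "dir_deriv v (\<lambda>w. c * coherent_state \<alpha> a w)
      = (\<lambda>w. (c * ((\<Sum>j\<in>UNIV. cnj (a $ j) * v $ j) / of_real \<alpha>)) * coherent_state \<alpha> a w)"
    and "(\<lambda>w. c * coherent_state \<alpha> a w) differentiable (at w)"
proof -
  define L where "L = (\<lambda>w :: complex ^ 'n. (\<Sum>j\<in>UNIV. cnj (a $ j) * w $ j) / of_real \<alpha>)"
  have "bounded_linear L"
    unfolding L_def
    by (intro linear_conv_bounded_linear[THEN iffD1] linearI)
       (simp_all add: distrib_left sum.distrib add_divide_distrib scaleR_conv_of_real[where 'a = complex] sum_distrib_left mult_ac)
  then have "((\<lambda>w. L w - of_real ((norm a)\<^sup>2 / (2 * \<alpha>))) has_derivative L) (at w)" for w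
    using has_derivative_diff[OF bounded_linear_imp_has_derivative has_derivative_const] by fastforce
  from has_derivative_compose[OF this DERIV_exp[unfolded has_field_derivative_def]]
  have "(coherent_state \<alpha> a has_derivative (\<lambda>v. coherent_state \<alpha> a w * L v)) (at w)" for w
    by (simp add: coherent_state_def[abs_def] L_def)
  from has_derivative_mult_right[OF this, of c]
  have d: "((\<lambda>w. c * coherent_state \<alpha> a w) has_derivative (\<lambda>v. (c * L v) * coherent_state \<alpha> a w)) (at w)" for w
    by (simp add: mult_ac)
  then show "(\<lambda>w. c * coherent_state \<alpha> a w) differentiable (at w)"
    by (rule differentiableI)
  show "dir_deriv v (\<lambda>w. c * coherent_state \<alpha> a w)
      = (\<lambda>w. (c * ((\<Sum>j\<in>UNIV. cnj (a $ j) * v $ j) / of_real \<alpha>)) * coherent_state \<alpha> a w)"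
    unfolding dir_deriv_def frechet_derivative_at[OF d, symmetric] L_def ..
qed

text \<open>The function is holomorphic: its derivative in direction \<open>axis k c\<close> is
  proportional to \<open>c\<close>, so the contributions of 1 and \<i> cancel in
  \<open>wirtinger_bar\<close>.\<close>

lemma pluriharmonic_coherent_state:
  fixes a :: "complex ^ 'n"
  shows "pluriharmonic (coherent_state \<alpha> a)"
proof -
  let ?f = "coherent_state \<alpha> a"
  have d1: "dir_deriv v ?f = (\<lambda>w. ((\<Sum>j\<in>UNIV. cnj (a $ j) * v $ j) / of_real \<alpha>) * ?f w)" for v
    using dir_deriv_coherent_state(1)[of v 1] by simp
  have diff: "?f differentiable (at w)" for w
    using dir_deriv_coherent_state(2)[of 1] by simp
  then have cont: "continuous_on UNIV ?f"
    by (intro continuous_at_imp_continuous_on ballI differentiable_imp_continuous_within)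
  have "(\<Sum>j\<in>UNIV. cnj (a $ j) * axis k c $ j) = cnj (a $ k) * c" for k c
    by (simp add: axis_def if_distrib[of "\<lambda>x. _ * x"] cong: if_cong)
  then have "wirtinger_bar k ?f = (\<lambda>w. 0)" for k
    by (simp add: wirtinger_bar_def[abs_def] d1 algebra_simps)
  moreover have "wirtinger j (\<lambda>w :: complex ^ 'n. 0) w = 0" for j and w :: "complex ^ 'n"
    by (simp add: wirtinger_def dir_deriv_def)
  moreover have "twice_cont_differentiable ?f"
    unfolding twice_cont_differentiable_def d1 dir_deriv_coherent_state(1)
    by (intro conjI allI diff dir_deriv_coherent_state(2) continuous_intros cont)
  ultimately show ?thesis
    by (simp add: pluriharmonic_def)
qed

lemma cmod_coherent_state:
  "cmod (coherent_state \<alpha> a w) = exp (a \<bullet> w / \<alpha> - (norm a)\<^sup>2 / (2 * \<alpha>))"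
proof -
  have "Re (\<Sum>j\<in>UNIV. cnj (a $ j) * w $ j) = a \<bullet> w"
    by (simp add: inner_vec_def inner_complex_def)
  then show ?thesis
    by (simp add: coherent_state_def norm_exp_eq_Re)
qed

text \<open>Completing the square gives a Gaussian centred at \<open>a\<close>. The form
  \<open>- a + w\<close> fits \<open>nn_integral_translate\<close>.\<close>

lemma weighted_power_coherent_state:
  "weighted_power p \<alpha> (coherent_state \<alpha> a) w = exp (- (p / (2 * \<alpha>)) * (norm (- a + w))\<^sup>2)"
proof -
  have sq: "(norm (- a + w))\<^sup>2 = (norm a)\<^sup>2 - 2 * (a \<bullet> w) + (norm w)\<^sup>2"
    by (simp add: power2_norm_eq_inner inner_diff_left inner_diff_right inner_commute)
  \<comment> \<open>At \<open>\<alpha> = 0\<close> every quotient is 0, because division by zero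
    yields zero.\<close>
  have e: "a \<bullet> w / \<alpha> - (norm a)\<^sup>2 / (2 * \<alpha>) + - (norm w)\<^sup>2 / (2 * \<alpha>) = - (norm (- a + w))\<^sup>2 / (2 * \<alpha>)"
    unfolding sq by (cases "\<alpha> = 0") (simp_all add: field_simps)
  have "weighted_modulus \<alpha> (coherent_state \<alpha> a) w = exp (- (norm (- a + w))\<^sup>2 / (2 * \<alpha>))"
    unfolding weighted_modulus_def cmod_coherent_state exp_add[symmetric] e ..
  then show ?thesis
    by (simp add: weighted_power_eq exp_powr_real mult_ac)
qed

text \<open>The weighted powers for different \<open>a\<close> are translates of one integrable
  Gaussian, so the norm does not depend on \<open>a\<close>.\<close>

lemma coherent_states_bounded:
  fixes a :: "complex ^ 'n"
  assumes p: "p \<ge> 1" and \<alpha>: "\<alpha> > 0"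
  shows "coherent_state \<alpha> a \<in> PH_space p \<alpha>"
    and "Lp_norm p \<alpha> (coherent_state \<alpha> a) = Lp_norm p \<alpha> (coherent_state \<alpha> (0 :: complex ^ 'n))"
proof -
  define g where "g = (\<lambda>w :: complex ^ 'n. ennreal (exp (- (p / (2 * \<alpha>)) * (norm w)\<^sup>2)))"
  have "(\<integral>\<^sup>+w. weighted_power p \<alpha> (coherent_state \<alpha> a) w \<partial>lebesgue) = (\<integral>\<^sup>+w. g w \<partial>lborel)" for a :: "complex ^ 'n"
  proof -
    have "(\<integral>\<^sup>+w. weighted_power p \<alpha> (coherent_state \<alpha> a) w \<partial>lebesgue) = (\<integral>\<^sup>+w. g (- a + w) \<partial>lborel)"
      by (simp only: nn_integral_completion weighted_power_coherent_state g_def)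
    also have "\<dots> = (\<integral>\<^sup>+w. g w \<partial>lborel)"
      by (rule nn_integral_translate) (unfold g_def, measurable)
    finally show ?thesis .
  qed
  then have N: "Lp_norm_power p \<alpha> (coherent_state \<alpha> a)
      = ennreal (p ^ CARD('n) / (2 * pi * \<alpha>) ^ CARD('n)) * (\<integral>\<^sup>+w. g w \<partial>lborel)" for a :: "complex ^ 'n"
    by (simp add: Lp_norm_power_def)
  then show "Lp_norm p \<alpha> (coherent_state \<alpha> a) = Lp_norm p \<alpha> (coherent_state \<alpha> (0 :: complex ^ 'n))"
    by (simp add: Lp_norm_def)
  have "(\<integral>\<^sup>+w. g w \<partial>lborel) < \<infinity>"
    unfolding g_def using p \<alpha> by (intro nn_integral_exp_neg_norm_squared_finite) auto
  then have "Lp_norm_power p \<alpha> (coherent_state \<alpha> a) < \<infinity>"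
    unfolding N by (auto simp: ennreal_mult_less_top)
  moreover have "coherent_state \<alpha> a \<in> borel_measurable lebesgue"
    by (rule measurable_completion, unfold measurable_lborel2)
       (intro borel_measurable_continuous_onI pluriharmonic_continuous pluriharmonic_coherent_state)
  ultimately show "coherent_state \<alpha> a \<in> PH_space p \<alpha>"
    by (simp add: PH_space_def Lp_space_def pluriharmonic_coherent_state)
qed

text \<open>If |w| <= R and |z m| >= 4 R, then by Cauchy-Schwarz the linear term of the exponent
  takes up at most half of the quadratic one, which leaves decay of order exp (- m^2 / (4 \<alpha>))
  uniformly on \<open>K\<close>.\<close>

lemma uniform_limit_coherent_states:
  fixes z :: "nat \<Rightarrow> complex ^ 'n"
  assumes \<alpha>: "\<alpha> > 0" and z: "\<And>m. real m \<le> norm (z m)" and K: "compact K"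
  shows "uniform_limit K (\<lambda>m. coherent_state \<alpha> (z m)) (\<lambda>_. 0) sequentially"
proof -
  obtain R where R: "\<And>w. w \<in> K \<Longrightarrow> norm w \<le> R"
    using compact_imp_bounded[OF K] by (auto simp: bounded_iff)
  have ev: "eventually (\<lambda>m. real m \<ge> 4 * R) sequentially"
    by real_asymp
  have lim: "(\<lambda>m. exp (- (real m)\<^sup>2 / (4 * \<alpha>))) \<longlonglongrightarrow> 0"
    using \<alpha> by real_asymp
  have "eventually (\<lambda>m. \<forall>w\<in>K. cmod (coherent_state \<alpha> (z m) w) < e) sequentially" if "e > 0" for e
    using ev order_tendstoD(2)[OF lim that]
  proof (eventually_elim, intro ballI)
    fix m w
    assume m: "4 * R \<le> real m" "exp (- (real m)\<^sup>2 / (4 * \<alpha>)) < e" and w: "w \<in> K"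
    have "z m \<bullet> w \<le> norm (z m) * norm w"
      by (rule norm_cauchy_schwarz)
    also have "\<dots> \<le> norm (z m) * (norm (z m) / 4)"
      using R[OF w] m(1) z[of m] by (intro mult_left_mono) auto
    finally have "z m \<bullet> w - (norm (z m))\<^sup>2 / 2 \<le> - (norm (z m))\<^sup>2 / 4"
      by (simp add: power2_eq_square)
    also have "\<dots> \<le> - (real m)\<^sup>2 / 4"
      using power_mono[OF z[of m], of 2] by simp
    finally have "(z m \<bullet> w - (norm (z m))\<^sup>2 / 2) / \<alpha> \<le> (- (real m)\<^sup>2 / 4) / \<alpha>"
      using \<alpha> by (intro divide_right_mono) auto
    then have "cmod (coherent_state \<alpha> (z m) w) \<le> exp (- (real m)\<^sup>2 / (4 * \<alpha>))"
      by (simp add: cmod_coherent_state diff_divide_distrib)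
    then show "cmod (coherent_state \<alpha> (z m) w) < e"
      using m(2) by linarith
  qed
  then show ?thesis
    by (auto simp: uniform_limit_iff)
qed

lemma vanishing_Carleson_imp_emeasure_ball_tendsto_0:
  fixes \<mu> :: "(complex ^ 'n) measure"
  assumes p: "p \<ge> 1" and \<alpha>: "\<alpha> > 0" and r: "r > 0" and \<mu>: "sets \<mu> = sets borel"
    and V: "vanishing_Carleson p \<alpha> \<mu>"
  shows "((\<lambda>z. emeasure \<mu> (ball z r)) \<longlongrightarrow> 0) at_infinity"
proof (rule tendsto_0_ennrealI, rule ccontr)
  fix e :: real
  assume e: "e > 0" and "\<not> eventually (\<lambda>z. emeasure \<mu> (ball z r) \<le> ennreal e) at_infinity"
  \<comment> \<open>Failure of the limit gives, beyond every radius, a ball of \<mu>-measure above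
    \<open>e\<close>. The coherent states at these centres are the test sequence.\<close>
  then have "\<forall>m :: nat. \<exists>z. real m \<le> norm z \<and> ennreal e < emeasure \<mu> (ball z r)"
    by (force simp: eventually_at_infinity not_le)
  then obtain z where z: "\<And>m. real m \<le> norm (z m)" "\<And>m :: nat. ennreal e < emeasure \<mu> (ball (z m) r)"
    by metis
  \<comment> \<open>The infimum of the Gaussian over a ball of radius \<open>r\<close> around its
    centre, so each test integral is at least \<open>d * e\<close>.\<close>
  define d where "d = exp (- (p / (2 * \<alpha>)) * r\<^sup>2)"
  have d: "d > 0" by (simp add: d_def)
  have "(\<lambda>m. \<integral>\<^sup>+w. ennreal (weighted_power p \<alpha> (coherent_state \<alpha> (z m)) w) \<partial>\<mu>) \<longlonglongrightarrow> 0"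
    using V unfolding vanishing_Carleson_def
  proof (elim allE[of _ "\<lambda>m. coherent_state \<alpha> (z m)"] mp, intro conjI allI exI impI)
    show "coherent_state \<alpha> (z m) \<in> PH_space p \<alpha>" for m
      by (rule coherent_states_bounded(1)[OF p \<alpha>])
    show "Lp_norm p \<alpha> (coherent_state \<alpha> (z m)) \<le> Lp_norm p \<alpha> (coherent_state \<alpha> (0 :: complex ^ 'n))" for m
      using coherent_states_bounded(2)[OF p \<alpha>, of "z m"] by simp
    show "uniform_limit K (\<lambda>m. coherent_state \<alpha> (z m)) (\<lambda>_. 0) sequentially" if "compact K" for K
      by (rule uniform_limit_coherent_states[OF \<alpha> z(1) that])
  qed
  then have "eventually (\<lambda>m. (\<integral>\<^sup>+w. ennreal (weighted_power p \<alpha> (coherent_state \<alpha> (z m)) w) \<partial>\<mu>) < ennreal (d * e)) sequentially"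
    by (rule order_tendstoD(2)) (use d e in simp)
  then obtain m where m: "(\<integral>\<^sup>+w. ennreal (weighted_power p \<alpha> (coherent_state \<alpha> (z m)) w) \<partial>\<mu>) < ennreal (d * e)"
    by (auto simp: eventually_sequentially)
  have "ennreal (d * e) = ennreal d * ennreal e"
    using d e by (simp add: ennreal_mult)
  also have "\<dots> \<le> ennreal d * emeasure \<mu> (ball (z m) r)"
    using z(2)[of m] by (intro mult_left_mono) auto
  also have "\<dots> = (\<integral>\<^sup>+w. ennreal d * indicator (ball (z m) r) w \<partial>\<mu>)"
    using \<mu> by (simp add: nn_integral_cmult_indicator)
  also have "\<dots> \<le> (\<integral>\<^sup>+w. ennreal (weighted_power p \<alpha> (coherent_state \<alpha> (z m)) w) \<partial>\<mu>)"
  proof (intro nn_integral_mono)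
    fix w
    have "d \<le> weighted_power p \<alpha> (coherent_state \<alpha> (z m)) w" if "w \<in> ball (z m) r"
    proof -
      have "(norm (- z m + w))\<^sup>2 \<le> r\<^sup>2"
        using that by (intro power_mono) (auto simp: dist_norm norm_minus_commute)
      then have "(p / (2 * \<alpha>)) * (norm (- z m + w))\<^sup>2 \<le> (p / (2 * \<alpha>)) * r\<^sup>2"
        using p \<alpha> by (intro mult_left_mono) auto
      then show ?thesis
        by (simp add: d_def weighted_power_coherent_state)
    qed
    then show "ennreal d * indicator (ball (z m) r) w \<le> ennreal (weighted_power p \<alpha> (coherent_state \<alpha> (z m)) w)"
      by (auto split: split_indicator intro!: ennreal_leI)
  qed
  finally show False using m by simp
qed

section \<open>From vanishing ball measures to vanishing Carleson\<close>

lemma measurable_weighted_power: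
  assumes "pluriharmonic f" and "\<alpha> \<noteq> 0"
  shows "weighted_power p \<alpha> f \<in> borel_measurable borel"
proof -
  have [measurable]: "weighted_modulus \<alpha> f \<in> borel_measurable borel"
    using assms by (intro borel_measurable_continuous_onI continuous_weighted_modulus pluriharmonic_continuous)
  show ?thesis
    unfolding weighted_power_eq[abs_def] by measurable
qed

lemma nn_integral_weighted_power_le_Lp_norm:
  fixes f :: "complex ^ 'n \<Rightarrow> complex"
  assumes p: "p \<ge> 1" and \<alpha>: "\<alpha> > 0" and f: "f \<in> PH_space p \<alpha>" and K: "Lp_norm p \<alpha> f \<le> K"
  shows "(\<integral>\<^sup>+z. weighted_power p \<alpha> f z \<partial>lborel) \<le> ennreal (K powr p * (2 * pi * \<alpha>) ^ CARD('n) / p ^ CARD('n))"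
proof -
  define c where "c = p ^ CARD('n) / (2 * pi * \<alpha>) ^ CARD('n)"
  have c: "c > 0" using p \<alpha> by (simp add: c_def)
  define X where "X = enn2real (Lp_norm_power p \<alpha> f)"
  \<comment> \<open>Membership in \<open>Lp_space\<close> makes the norm power finite, so
    \<open>enn2real\<close> loses nothing; the completion does not change the integral of a
    nonnegative function.\<close>
  have N: "ennreal c * (\<integral>\<^sup>+z. weighted_power p \<alpha> f z \<partial>lborel) = ennreal X"
    using f by (simp add: X_def PH_space_def Lp_space_def) (simp add: Lp_norm_power_def c_def nn_integral_completion)
  have "X = (X powr (1 / p)) powr p"
    using p by (simp add: powr_powr X_def)
  also have "\<dots> \<le> K powr p"
    using p K by (intro powr_mono2) (auto simp: Lp_norm_def X_def)
  finally have X: "X \<le> K powr p" .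
  have "(\<integral>\<^sup>+z. weighted_power p \<alpha> f z \<partial>lborel) = ennreal (1 / c) * (ennreal c * (\<integral>\<^sup>+z. weighted_power p \<alpha> f z \<partial>lborel))"
    using c by (simp add: mult.assoc[symmetric] ennreal_mult[symmetric])
  also have "\<dots> \<le> ennreal (1 / c) * ennreal (K powr p)"
    unfolding N by (intro mult_left_mono ennreal_leI X) simp
  also have "\<dots> = ennreal (1 / c * K powr p)"
    using c by (intro ennreal_mult[symmetric]) auto
  also have "1 / c * K powr p = K powr p * (2 * pi * \<alpha>) ^ CARD('n) / p ^ CARD('n)"
    by (simp add: c_def)
  finally show ?thesis .
qed

lemma emeasure_ball_tendsto_0_imp_vanishing_Carleson:
  fixes \<mu> :: "(complex ^ 'n) measure"
  assumes p: "p \<ge> 1" and \<alpha>: "\<alpha> > 0" and r: "r > 0" and \<mu>: "borel_measure_on_Cn \<mu>"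
    and lim: "((\<lambda>z. emeasure \<mu> (ball z r)) \<longlongrightarrow> 0) at_infinity"
  shows "vanishing_Carleson p \<alpha> \<mu>"
  unfolding vanishing_Carleson_def
proof (intro allI impI, elim conjE exE)
  fix f :: "nat \<Rightarrow> complex ^ 'n \<Rightarrow> complex" and K
  assume f: "\<forall>m. f m \<in> PH_space p \<alpha>" and K: "\<forall>m. Lp_norm p \<alpha> (f m) \<le> K"
    and unif: "\<forall>S. compact S \<longrightarrow> uniform_limit S f (\<lambda>_. 0) sequentially"
  have sets: "sets \<mu> = sets borel" and fin: "\<And>S. compact S \<Longrightarrow> emeasure \<mu> S < \<infinity>"
    using \<mu> by (auto simp: borel_measure_on_Cn_def)
  have ph: "pluriharmonic (f m)" for m
    using f by (simp add: PH_space_def)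
  have \<alpha>0: "\<alpha> \<noteq> 0" using \<alpha> by simp
  note [measurable] = measurable_weighted_power[OF ph \<alpha>0]
  obtain C \<rho> :: real where C: "C > 0" and \<rho>: "\<rho> > 0"
    and sub: "\<And>f (z :: complex ^ 'n). pluriharmonic f \<Longrightarrow>
      ennreal (weighted_power p \<alpha> f z) \<le> ennreal C * (\<integral>\<^sup>+w\<in>ball z \<rho>. weighted_power p \<alpha> f w \<partial>lborel)"
    using weighted_power_bound[OF p \<alpha>] by metis
  define B where "B = K powr p * (2 * pi * \<alpha>) ^ CARD('n) / p ^ CARD('n)"
  have B: "B \<ge> 0" using p \<alpha> by (simp add: B_def)
  have norm_bound: "(\<integral>\<^sup>+z. weighted_power p \<alpha> (f m) z \<partial>lborel) \<le> ennreal B" for m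
    unfolding B_def using f K by (intro nn_integral_weighted_power_le_Lp_norm p \<alpha>) auto
  show "(\<lambda>m. \<integral>\<^sup>+z. ennreal (weighted_power p \<alpha> (f m) z) \<partial>\<mu>) \<longlonglongrightarrow> 0"
  proof (rule tendsto_0_ennrealI)
    fix e :: real assume e: "e > 0"
    \<comment> \<open>Chosen so that C \<eta> B <= e / 2; adding 1 to \<open>B\<close> avoids a zero
      denominator.\<close>
    define \<eta> where "\<eta> = e / (2 * C * (B + 1))"
    have \<eta>: "\<eta> > 0" using e C B by (simp add: \<eta>_def)
    have "eventually (\<lambda>w. emeasure \<mu> (ball w \<rho>) < ennreal \<eta>) at_infinity"
      by (rule order_tendstoD(2)[OF emeasure_ball_tendsto_0_radius[OF sets r lim]]) (use \<eta> in simp)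
    then obtain R where R: "\<And>w. R \<le> norm w \<Longrightarrow> emeasure \<mu> (ball w \<rho>) < ennreal \<eta>"
      by (auto simp: eventually_at_infinity)
    \<comment> \<open>This closed ball contains all balls of radius \<rho> with centre in
      \<open>cball 0 R\<close>, and it has finite measure because \<mu> is finite on compact
      sets.\<close>
    define M where "M = enn2real (emeasure \<mu> (cball 0 (R + \<rho>)))"
    have M: "emeasure \<mu> (cball 0 (R + \<rho>)) = ennreal M" "M \<ge> 0"
      using fin[OF compact_cball, of 0 "R + \<rho>"] by (auto simp: M_def ennreal_enn2real_if)
    define V where "V = measure lborel (cball (0 :: complex ^ 'n) R)"
    have V: "emeasure lborel (cball (0 :: complex ^ 'n) R) = ennreal V" "V \<ge> 0"
      unfolding V_def using emeasure_lborel_cball_finite[of "0 :: complex ^ 'n" R]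
      by (auto intro!: emeasure_eq_ennreal_measure)
    have [measurable]: "cball (0 :: complex ^ 'n) R \<in> sets borel" by simp
    \<comment> \<open>Chosen so that C d M V <= e / 2. Since \<open>d\<close> bounds the p-th power,
      uniform convergence is used below with \<open>d powr (1 / p)\<close>.\<close>
    define d where "d = e / (2 * C * (M * V + 1))"
    have MV: "M * V \<ge> 0" using M V by simp
    have d: "d > 0" using e C MV by (simp add: d_def)
    have "eventually (\<lambda>m. \<forall>w\<in>cball 0 R. dist (f m w) 0 < d powr (1 / p)) sequentially"
      using unif d by (auto simp: uniform_limit_iff)
    then show "eventually (\<lambda>m. (\<integral>\<^sup>+z. ennreal (weighted_power p \<alpha> (f m) z) \<partial>\<mu>) \<le> ennreal e) sequentially"
    proof eventually_elim
      fix m assume small: "\<forall>w\<in>cball 0 R. dist (f m w) 0 < d powr (1 / p)"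
      \<comment> \<open>Inside \<open>cball 0 R\<close> the function is small and the ball measure
        is merely bounded; outside, the ball measure is small and the function is controlled by its
        norm.\<close>
      have pointwise: "ennreal (weighted_power p \<alpha> (f m) w) * emeasure \<mu> (ball w \<rho>)
          \<le> ennreal (d * M) * indicator (cball 0 R) w + ennreal \<eta> * ennreal (weighted_power p \<alpha> (f m) w)" for w
      proof (cases "w \<in> cball 0 R")
        case True
        have "weighted_modulus \<alpha> (f m) w \<le> cmod (f m w) * 1"
          unfolding weighted_modulus_def using \<alpha> by (intro mult_left_mono) auto
        also have "\<dots> \<le> d powr (1 / p)"
          using small True by (auto intro: less_imp_le)
        finally have "weighted_power p \<alpha> (f m) w \<le> (d powr (1 / p)) powr p"
          unfolding weighted_power_eq using p by (intro powr_mono2) auto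
        then have 1: "weighted_power p \<alpha> (f m) w \<le> d"
          using p d by (simp add: powr_powr)
        have "ball w \<rho> \<subseteq> cball 0 (R + \<rho>)"
          using True by (subst ball_subset_cball_iff) (auto simp: norm_minus_commute)
        then have "emeasure \<mu> (ball w \<rho>) \<le> ennreal M"
          unfolding M(1)[symmetric] by (intro emeasure_mono) (auto simp: sets)
        then have "ennreal (weighted_power p \<alpha> (f m) w) * emeasure \<mu> (ball w \<rho>) \<le> ennreal d * ennreal M"
          by (intro mult_mono ennreal_leI 1) auto
        also have "\<dots> = ennreal (d * M) * indicator (cball 0 R) w"
          using True d M(2) by (simp add: ennreal_mult)
        finally show ?thesis
          by (rule order_trans) (simp add: add_increasing2)
      next
        case False
        then have "emeasure \<mu> (ball w \<rho>) \<le> ennreal \<eta>"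
          using R[of w] by (simp add: less_imp_le)
        then show ?thesis
          using False mult_left_mono[of _ _ "ennreal (weighted_power p \<alpha> (f m) w)"] by (simp add: mult.commute)
      qed
      have "(\<integral>\<^sup>+z. ennreal (weighted_power p \<alpha> (f m) z) \<partial>\<mu>)
          \<le> ennreal C * (\<integral>\<^sup>+w. ennreal (weighted_power p \<alpha> (f m) w) * emeasure \<mu> (ball w \<rho>) \<partial>lborel)"
        using sub[OF ph]
        by (intro nn_integral_le_averaged_measure sets sigma_finite_if_finite_on_compact fin) auto
      also have "\<dots> \<le> ennreal C * (\<integral>\<^sup>+w. ennreal (d * M) * indicator (cball 0 R) w + ennreal \<eta> * ennreal (weighted_power p \<alpha> (f m) w) \<partial>lborel)"
        by (intro mult_left_mono nn_integral_mono pointwise) simp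
      also have "\<dots> = ennreal C * (ennreal (d * M) * ennreal V + ennreal \<eta> * (\<integral>\<^sup>+w. weighted_power p \<alpha> (f m) w \<partial>lborel))"
        unfolding V(1)[symmetric] by (subst nn_integral_add) (auto simp: nn_integral_cmult nn_integral_cmult_indicator)
      also have "\<dots> \<le> ennreal C * (ennreal (d * M) * ennreal V + ennreal \<eta> * ennreal B)"
        by (intro mult_left_mono add_left_mono norm_bound) auto
      also have "\<dots> = ennreal (C * (d * M * V + \<eta> * B))"
        using C d M(2) V(2) \<eta> B by (simp add: ennreal_mult[symmetric] ennreal_plus[symmetric] del: ennreal_plus)
      also have "\<dots> \<le> ennreal e"
      proof (rule ennreal_leI)
        have "C * (d * M * V) = e / 2 * (M * V / (M * V + 1))"
          using C MV by (simp add: d_def)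
        also have "\<dots> \<le> e / 2 * 1"
          using e MV by (intro mult_left_mono) auto
        finally have 1: "C * (d * M * V) \<le> e / 2" by simp
        have "C * (\<eta> * B) = e / 2 * (B / (B + 1))"
          using C B by (simp add: \<eta>_def)
        also have "\<dots> \<le> e / 2 * 1"
          using e B by (intro mult_left_mono) auto
        finally show "C * (d * M * V + \<eta> * B) \<le> e"
          using 1 by (simp add: distrib_left)
      qed
      finally show "(\<integral>\<^sup>+z. ennreal (weighted_power p \<alpha> (f m) z) \<partial>\<mu>) \<le> ennreal e" .
    qed
  qed
qed

theorem theorem2p8:
  fixes p \<alpha> r :: real and \<mu> :: "(complex ^ 'n) measure"
  assumes "p \<ge> 1" and "\<alpha> > 0" and "r > 0"
    and "borel_measure_on_Cn \<mu>"
  shows "vanishing_Carleson p \<alpha> \<mu> \<longleftrightarrow>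
         ((\<lambda>z. emeasure \<mu> (ball z r)) \<longlongrightarrow> 0) at_infinity"
  using vanishing_Carleson_imp_emeasure_ball_tendsto_0[of p \<alpha> r \<mu>]
    emeasure_ball_tendsto_0_imp_vanishing_Carleson[of p \<alpha> r \<mu>] assms
  by (auto simp: borel_measure_on_Cn_def)

end
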